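(* Let $\mathcal M=\langle\mathcal S,\mathcal A,P,c,\gamma\rangle$ and $\hat{\mathcal M}=\langle\mathcal S,\mathcal A,\hat P,\hat c,\gamma\rangle$ be two MDPs with costs bounded below, let $w:\mathcal S\to[1,\infty)$ and $\kappa>0$ with $\gamma\kappa<1$. Assume that both models are DP-solvable with respect to $w$, that $\mathcal G(V^\star)\cap\Pi_S(\kappa,w)\neq\emptyset$ and that $\hat{\mathcal G}(\hat V^\star)\cap\Pi_S(\kappa,w)\cap\hat\Pi_S(\kappa,w)\neq\emptyset$. Let $\pi^\star\in\mathcal G(V^\star)\cap\Pi_S(\kappa,w)$ and $\hat\pi^\star\in\hat{\mathcal G}(\hat V^\star)\cap\Pi_S(\kappa,w)\cap\hat\Pi_S(\kappa,w)$ (the optimal policies of $\mathcal M$ and $\hat{\mathcal M}$). Let $\boldsymbol\alpha=(\alpha_1,\alpha_2)\in\mathbb R^2$ with $\alpha_1>0$ and let $\mathfrak F$ be a convex and balanced subset of $\mathcal V_w$. Then: 1. $$\|V^{\hat\pi^\star}-V^\star\|_w\le\frac{1}{\alpha_1(1-\gamma\kappa)}\Bigl[\varepsilon_{\boldsymbol\alpha}(\hat\pi^\star,\hat\pi^\star)+\varepsilon_{\boldsymbol\alpha}(\pi^\star,\hat\pi^\star)+\gamma\rho_{\mathfrak F}(\hat V^\star)\bigl(\delta_{\mathfrak F}(\hat\pi^\star,\hat\pi^\star)+\delta_{\mathfrak F}(\pi^\star,\hat\pi^\star)\bigr)\Bigr]$$ and $$\|V^{\hat\pi^\star}-V^\star\|_w\le\frac{1}{\alpha_1(1-\gamma\kappa)}\bigl[\varepsilon_{\boldsymbol\alpha}(\hat\pi^\star,\hat\pi^\star)+\alpha_1\gamma\rho_{\mathfrak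 F}(V^\star)\delta_{\mathfrak F}(\hat\pi^\star,\hat\pi^\star)\bigr]+\frac{1+\gamma\kappa}{\alpha_1(1-\gamma\kappa)^2}\bigl[\varepsilon_{\boldsymbol\alpha}(\pi^\star,\hat\pi^\star)+\alpha_1\gamma\rho_{\mathfrak F}(V^\star)\delta_{\mathfrak F}(\pi^\star,\hat\pi^\star)\bigr].$$ 2. If in addition $\mathcal G_{\boldsymbol\alpha}(\hat V^\star)\cap\Pi_S(\kappa,w)\neq\emptyset$, then for all $\mu^\star\in\mathcal G_{\boldsymbol\alpha}(\hat V^\star)\cap\Pi_S(\kappa,w)$, $$\|V^{\hat\pi^\star}-V^\star\|_w\le\frac{1}{\alpha_1(1-\gamma\kappa)}\Bigl[\varepsilon_{\boldsymbol\alpha}(\hat\pi^\star,\hat\pi^\star)+\varepsilon_{\boldsymbol\alpha}(\mu^\star,\hat\pi^\star)+\gamma\rho_{\mathfrak F}(\hat V^\star)\bigl(\delta_{\mathfrak F}(\hat\pi^\star,\hat\pi^\star)+\delta_{\mathfrak F}(\mu^\star,\hat\pi^\star)\bigr)\Bigr].$$ 3. If (in addition to the hypotheses preceding item 1) $\hat{\mathcal G}(V^\star_{\boldsymbol\alpha})\cap\hat\Pi_S(\kappa,w)\neq\emptyset$, then for all $\hat\mu^\star\in\hat{\mathcal G}(V^\star_{\boldsymbol\alpha})\cap\hat\Pi_S(\kappa,w)$, $$\|V^{\hat\pi^\star}-V^\star\|_w\le\frac{1}{\alpha_1(1-\gamma\kappa)}\bigl[\varepsilon_{\boldsymbol\alpha}(\hat\pi^\star,\hat\pi^\star)+\alpha_1\gamma\rho_{\mathfrak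 F}(V^\star)\delta_{\mathfrak F}(\hat\pi^\star,\hat\pi^\star)\bigr]+\frac{1+\gamma\kappa}{\alpha_1(1-\gamma\kappa)^2}\bigl[\varepsilon_{\boldsymbol\alpha}(\pi^\star,\hat\mu^\star)+\alpha_1\gamma\rho_{\mathfrak F}(V^\star)\delta_{\mathfrak F}(\pi^\star,\hat\mu^\star)\bigr].$$ 4. If (in addition to the hypotheses preceding item 1) for each $a\in\mathcal A$ the open-loop policy $\pi_a$ (selecting $a$ with probability one in every state) belongs to $\Pi_S(\kappa,w)\cap\hat\Pi_S(\kappa,w)$, and moreover $\mathcal G(\hat V^\star)$ and $\hat{\mathcal G}(V^\star)$ are nonempty, then $$\|V^{\hat\pi^\star}-V^\star\|_w\le\frac{2}{\alpha_1(1-\gamma\kappa)}\bigl[\varepsilon^{\max}_{\boldsymbol\alpha}+\gamma\rho_{\mathfrak F}(\hat V^\star)\delta^{\max}_{\mathfrak F}\bigr]$$ and $$\|V^{\hat\pi^\star}-V^\star\|_w\le\frac{2}{\alpha_1(1-\gamma\kappa)^2}\bigl[\varepsilon^{\max}_{\boldsymbol\alpha}+\alpha_1\gamma\rho_{\mathfrak F}(V^\star)\delta^{\max}_{\mathfrak F}\bigr].$$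
   Context: MDPs. An MDP $\mathcal M=\langle\mathcal S,\mathcal A,P,c,\gamma\rangle$ consists of Borel spaces $\mathcal S$ (states) and $\mathcal A$ (actions), a stochastic kernel $P(\cdot\mid s,a)$ from $\mathcal S\times\mathcal A$ to $\mathcal S$, a measurable per-step cost $c:\mathcal S\times\mathcal A\to\mathbb R$ bounded from below, and a discount factor $\gamma\in(0,1)$. The second MDP $\hat{\mathcal M}$ has the same $\mathcal S,\mathcal A,\gamma$ but possibly different kernel $\hat P$ and cost $\hat c$; $c_{\min}\in\mathbb R$ is a constant with $c\ge c_{\min}$ and $\hat c\ge c_{\min}$. A policy is a stochastic kernel $\pi:\mathcal S\to\Delta(\mathcal A)$ (time-homogeneous, possibly randomized), where $\Delta(\cdot)$ denotes the set of probability measures; $\Pi$ is the set of all policies. Put $c_\pi(s)=\int_{\mathcal A}c(s,a)\pi(da|s)$, $P_\pi(ds'|s)=\int_{\mathcal A}\pi(da|s)P(ds'|s,a)$. The value function of $\pi$ is $V^\pi(s)=\mathbb E^\pi\bigl[\sum_{t\ge1}\gamma^{t-1}c(S_t,A_t)\mid S_1=s\bigr]$. Function space and operators. $\mathcal V$ is the set of measurable functions $\mathcal S\to[\frac{c_{\min}}{1-\gamma},\infty)\cup\{+\infty\}$. For $w:\mathcal S\to[1,\infty)$, $\|v\|_w=\sup_{s}|v(s)|/w(s)$ (also used for differences of functions), $\mathcal V_w=\{v\in\mathcal V:\|v\|_w<\infty\}$, and $\mathcal P_w=\{p\in\Delta(\mathcal S):\int w\,dp<\infty\}$. Bellman operators: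 $[\mathcal B^\pi v](s)=c_\pi(s)+\gamma\int v(s')P_\pi(ds'|s)$ and $[\mathcal B^\star v](s)=\inf_{a\in\mathcal A}\{c(s,a)+\gamma\int v(s')P(ds'|s,a)\}$. The set of one-step greedy policies is $\mathcal G(v)=\{\pi\in\Pi:\mathcal B^\pi v=\mathcal B^\star v\}$. DP-solvability. $\mathcal M$ is DP-solvable with respect to $w$ if (i) $\mathcal B^\star v\in\mathcal V_w$ for all $v\in\mathcal V_w$; (ii) there is $V^\star\in\mathcal V_w$ with $V^\star(s)\le V^\pi(s)$ for all $s$ and all $\pi\in\Pi$, with equality at all states for at least one $\pi\in\Pi$; (iii) $V^\star=\mathcal B^\star V^\star$. This $V^\star$ is the optimal value function. Stability. For $\kappa>0$ with $\gamma\kappa<1$, a policy $\pi$ is $(\kappa,w)$ stable for $\mathcal M$ if $\|c_\pi\|_w<\infty$ and $\int w(s')P_\pi(ds'|s)\le\kappa w(s)$ for all $s$. $\Pi_S(\kappa,w)$ is the set of $(\kappa,w)$-stable policies for $\mathcal M$. Hats denote the corresponding objects for $\hat{\mathcal M}$: $\hat c_\pi,\hat P_\pi,\hat V^\pi,\hat V^\star,\hat{\mathcal B}^\pi,\hat{\mathcal B}^\star,\hat{\mathcal G}(v),\hat\Pi_S(\kappa,w)$. $V^{\hat\pi^\star}$ is the value function of $\hat\pi^\star$ in $\mathcal M$. Affine transformation. $\mathcal M_{\boldsymbol\alpha}=\langle\mathcal S,\mathcal A,P,\alpha_1c+\alpha_2,\gamma\rangle$; $V^\star_{\boldsymbol\alpha}$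 is its optimal value function, $\mathcal B^\pi_{\boldsymbol\alpha},\mathcal B^\star_{\boldsymbol\alpha}$ its Bellman operators (cost $c$ replaced by $\alpha_1c+\alpha_2$), $\mathcal G_{\boldsymbol\alpha}(v)=\{\pi\in\Pi:\mathcal B^\pi_{\boldsymbol\alpha}v=\mathcal B^\star_{\boldsymbol\alpha}v\}$. Integral probability metric. For $\mathfrak F$ as in the claim and $\nu_1,\nu_2\in\mathcal P_w$: $d_{\mathfrak F}(\nu_1,\nu_2)=\sup_{f\in\mathfrak F}|\int f\,d\nu_1-\int f\,d\nu_2|$. The Minkowski functional of a measurable $f\in\mathcal V_w$ is $\rho_{\mathfrak F}(f)=\inf\{\rho>0:f/\rho\in\mathfrak F\}$ ($=+\infty$ if there is no such $\rho$). Products $\rho_{\mathfrak F}(f)\,d_{\mathfrak F}(\nu_1,\nu_2)$ are understood so that $|\int f\,d\nu_1-\int f\,d\nu_2|\le\rho_{\mathfrak F}(f)\,d_{\mathfrak F}(\nu_1,\nu_2)$ for every measurable $f\in\mathcal V_w$. Distances between models. For policies $\pi$ for $\mathcal M$ and $\hat\pi$ for $\hat{\mathcal M}$ with $P_\pi(\cdot|s),\hat P_{\hat\pi}(\cdot|s)\in\mathcal P_w$ for all $s$: $$\varepsilon_{\boldsymbol\alpha}(\pi,\hat\pi)=\sup_s\frac{|\alpha_1c_\pi(s)+\alpha_2-\hat c_{\hat\pi}(s)|}{w(s)},\qquad\delta_{\mathfrak F}(\pi,\hat\pi)=\sup_s\frac{d_{\mathfrak F}(P_\pi(\cdot|s),\hat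 P_{\hat\pi}(\cdot|s))}{w(s)},$$ and, under the open-loop hypothesis of item 4, $$\varepsilon^{\max}_{\boldsymbol\alpha}=\sup_{(s,a)\in\mathcal S\times\mathcal A}\frac{|\alpha_1c(s,a)+\alpha_2-\hat c(s,a)|}{w(s)},\qquad\delta^{\max}_{\mathfrak F}=\sup_{(s,a)\in\mathcal S\times\mathcal A}\frac{d_{\mathfrak F}(P(\cdot|s,a),\hat P(\cdot|s,a))}{w(s)}.$$ *)

theory Defs
  imports "HOL-Probability.Probability"
begin

section \<open>Extended Lebesgue integral\<close>

text \<open>
  Integral of an extended-real function as the difference of the integrals of its positive and
  negative part (the coercion \<^const>\<open>e2ennreal\<close> truncates at 0). It is only used where at most
  one of the two parts has an infinite integral.
\<close>

definition eint :: "'a measure \<Rightarrow> ('a \<Rightarrow> ereal) \<Rightarrow> ereal" where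
  "eint M f = enn2ereal (\<integral>\<^sup>+x. e2ennreal (f x) \<partial>M) - enn2ereal (\<integral>\<^sup>+x. e2ennreal (- f x) \<partial>M)"

section \<open>Markov decision processes\<close>

text \<open>
  State and action spaces are Borel subsets of Polish spaces. Functions on the state space are
  represented by the extensional functions on the carrier, so that equality of such functions is
  pointwise equality on the carrier. Outside the carriers, kernels, costs and policies are
  unconstrained and irrelevant.
\<close>

record ('s, 'a) mdp =
  states :: "'s set"
  actions :: "'a set"
  kernel :: "'s \<times> 'a \<Rightarrow> 's measure"
  cost :: "'s \<times> 'a \<Rightarrow> real"
  disc :: real

abbreviation state_space :: "('s::polish_space, 'a, 'x) mdp_scheme \<Rightarrow> 's measure" where
  "state_space M \<equiv> restrict_space borel (states M)"

abbreviation action_space :: "('s, 'a::polish_space, 'x) mdp_scheme \<Rightarrow> 'a measure" where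
  "action_space M \<equiv> restrict_space borel (actions M)"

abbreviation sa_space ::
  "('s::polish_space, 'a::polish_space, 'x) mdp_scheme \<Rightarrow> ('s \<times> 'a) measure" where
  "sa_space M \<equiv> state_space M \<Otimes>\<^sub>M action_space M"

definition is_mdp :: "('s::polish_space, 'a::polish_space) mdp \<Rightarrow> bool" where
  "is_mdp M \<longleftrightarrow>
     states M \<in> sets borel \<and> actions M \<in> sets borel \<and>
     kernel M \<in> sa_space M \<rightarrow>\<^sub>M prob_algebra (state_space M) \<and>
     cost M \<in> borel_measurable (sa_space M) \<and>
     (\<exists>b. \<forall>x \<in> states M \<times> actions M. b \<le> cost M x) \<and>
     0 < disc M \<and> disc M < 1"

definition policies :: "('s::polish_space, 'a::polish_space) mdp \<Rightarrow> ('s \<Rightarrow> 'a measure) set" where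
  "policies M = state_space M \<rightarrow>\<^sub>M prob_algebra (action_space M)"

definition cost_pol ::
  "('s::polish_space, 'a::polish_space) mdp \<Rightarrow> ('s \<Rightarrow> 'a measure) \<Rightarrow> 's \<Rightarrow> ereal" where
  "cost_pol M \<pi> s = eint (\<pi> s) (\<lambda>a. ereal (cost M (s, a)))"

definition kernel_pol ::
  "('s::polish_space, 'a::polish_space) mdp \<Rightarrow> ('s \<Rightarrow> 'a measure) \<Rightarrow> 's \<Rightarrow> 's measure" where
  "kernel_pol M \<pi> s = \<pi> s \<bind> (\<lambda>a. kernel M (s, a))"

definition open_loop :: "('s::polish_space, 'a::polish_space) mdp \<Rightarrow> 'a \<Rightarrow> 's \<Rightarrow> 'a measure" where
  "open_loop M a = (\<lambda>s. return (action_space M) a)"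

section \<open>Value functions\<close>

text \<open>
  The law of the trajectory \<open>(S\<^sub>1, A\<^sub>1), (S\<^sub>2, A\<^sub>2), \<dots>\<close> started at \<open>s\<close>, by the Ionescu-Tulcea
  theorem. Time is counted from 0, hence the discount \<open>disc M ^ t\<close> below.
\<close>

definition sa_law ::
  "('s::polish_space, 'a::polish_space) mdp \<Rightarrow> ('s \<Rightarrow> 'a measure) \<Rightarrow> 's \<Rightarrow> ('s \<times> 'a) measure" where
  "sa_law M \<pi> s = \<pi> s \<bind> (\<lambda>a. return (sa_space M) (s, a))"

primrec traj_step ::
  "('s::polish_space, 'a::polish_space) mdp \<Rightarrow> ('s \<Rightarrow> 'a measure) \<Rightarrow> 's \<Rightarrow>
   nat \<Rightarrow> (nat \<Rightarrow> 's \<times> 'a) \<Rightarrow> ('s \<times> 'a) measure" where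
  "traj_step M \<pi> s 0 = (\<lambda>\<omega>. sa_law M \<pi> s)"
| "traj_step M \<pi> s (Suc t) = (\<lambda>\<omega>. kernel M (\<omega> t) \<bind> sa_law M \<pi>)"

definition traj ::
  "('s::polish_space, 'a::polish_space) mdp \<Rightarrow> ('s \<Rightarrow> 'a measure) \<Rightarrow> 's \<Rightarrow> (nat \<Rightarrow> 's \<times> 'a) measure"
where
  "traj M \<pi> s =
     projective_family.lim UNIV (Ionescu_Tulcea.CI (traj_step M \<pi> s) (\<lambda>t. sa_space M))
       (\<lambda>t. sa_space M)"

definition val :: "('s::polish_space, 'a::polish_space) mdp \<Rightarrow> ('s \<Rightarrow> 'a measure) \<Rightarrow> 's \<Rightarrow> ereal" where
  "val M \<pi> = (\<lambda>s \<in> states M. eint (traj M \<pi> s) (\<lambda>\<omega>. \<Sum>t. ereal (disc M ^ t * cost M (\<omega> t))))"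

definition is_opt_val :: "('s::polish_space, 'a::polish_space) mdp \<Rightarrow> ('s \<Rightarrow> ereal) \<Rightarrow> bool" where
  "is_opt_val M V \<longleftrightarrow>
     V \<in> extensional (states M) \<and>
     (\<forall>\<pi> \<in> policies M. \<forall>s \<in> states M. V s \<le> val M \<pi> s) \<and>
     (\<exists>\<pi> \<in> policies M. \<forall>s \<in> states M. V s = val M \<pi> s)"

text \<open>There is at most one function satisfying \<^const>\<open>is_opt_val\<close>.\<close>

definition opt_val :: "('s::polish_space, 'a::polish_space) mdp \<Rightarrow> 's \<Rightarrow> ereal" where
  "opt_val M = (THE V. is_opt_val M V)"

definition affine_mdp ::
  "real \<Rightarrow> real \<Rightarrow> ('s::polish_space, 'a::polish_space) mdp \<Rightarrow> ('s, 'a) mdp" where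
  "affine_mdp \<alpha>1 \<alpha>2 M = M\<lparr>cost := (\<lambda>x. \<alpha>1 * cost M x + \<alpha>2)\<rparr>"

section \<open>Weighted norms, Bellman operators, DP-solvability, stability\<close>

text \<open>
  Norms and distances take values in \<^typ>\<open>ennreal\<close>, so a supremum over the empty set is 0.
\<close>

definition wnorm :: "'s set \<Rightarrow> ('s \<Rightarrow> real) \<Rightarrow> ('s \<Rightarrow> ereal) \<Rightarrow> ennreal" where
  "wnorm S w v = (SUP s\<in>S. e2ennreal (\<bar>v s\<bar> / ereal (w s)))"

definition Vfun :: "real \<Rightarrow> ('s::polish_space, 'a::polish_space) mdp \<Rightarrow> ('s \<Rightarrow> ereal) set" where
  "Vfun cmin M =
     {v \<in> extensional (states M). v \<in> borel_measurable (state_space M) \<and>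
        (\<forall>s \<in> states M. ereal (cmin / (1 - disc M)) \<le> v s)}"

definition Vw ::
  "real \<Rightarrow> ('s \<Rightarrow> real) \<Rightarrow> ('s::polish_space, 'a::polish_space) mdp \<Rightarrow> ('s \<Rightarrow> ereal) set" where
  "Vw cmin w M = {v \<in> Vfun cmin M. wnorm (states M) w v < \<infinity>}"

definition bellman_pol ::
  "('s::polish_space, 'a::polish_space) mdp \<Rightarrow> ('s \<Rightarrow> 'a measure) \<Rightarrow> ('s \<Rightarrow> ereal) \<Rightarrow> 's \<Rightarrow> ereal"
where
  "bellman_pol M \<pi> v =
     (\<lambda>s \<in> states M. cost_pol M \<pi> s + ereal (disc M) * eint (kernel_pol M \<pi> s) v)"

definition bellman_opt ::
  "('s::polish_space, 'a::polish_space) mdp \<Rightarrow> ('s \<Rightarrow> ereal) \<Rightarrow> 's \<Rightarrow> ereal" where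
  "bellman_opt M v =
     (\<lambda>s \<in> states M. INF a\<in>actions M. ereal (cost M (s, a)) + ereal (disc M) * eint (kernel M (s, a)) v)"

definition greedy ::
  "('s::polish_space, 'a::polish_space) mdp \<Rightarrow> ('s \<Rightarrow> ereal) \<Rightarrow> ('s \<Rightarrow> 'a measure) set" where
  "greedy M v = {\<pi> \<in> policies M. bellman_pol M \<pi> v = bellman_opt M v}"

definition dp_solvable ::
  "real \<Rightarrow> ('s \<Rightarrow> real) \<Rightarrow> ('s::polish_space, 'a::polish_space) mdp \<Rightarrow> bool" where
  "dp_solvable cmin w M \<longleftrightarrow>
     (\<forall>v \<in> Vw cmin w M. bellman_opt M v \<in> Vw cmin w M) \<and>
     (\<exists>V \<in> Vw cmin w M. is_opt_val M V \<and> V = bellman_opt M V)"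

definition stable_policies ::
  "real \<Rightarrow> ('s \<Rightarrow> real) \<Rightarrow> ('s::polish_space, 'a::polish_space) mdp \<Rightarrow> ('s \<Rightarrow> 'a measure) set" where
  "stable_policies \<kappa> w M =
     {\<pi> \<in> policies M. wnorm (states M) w (cost_pol M \<pi>) < \<infinity> \<and>
        (\<forall>s \<in> states M. (\<integral>\<^sup>+s'. ennreal (w s') \<partial>kernel_pol M \<pi> s) \<le> ennreal (\<kappa> * w s))}"

section \<open>Integral probability metrics and model distances\<close>

definition convex_fun_set :: "'s set \<Rightarrow> ('s \<Rightarrow> ereal) set \<Rightarrow> bool" where
  "convex_fun_set S F \<longleftrightarrow>
     (\<forall>f\<in>F. \<forall>g\<in>F. \<forall>t\<in>{0..1::real}. (\<lambda>s\<in>S. ereal t * f s + ereal (1 - t) * g s) \<in> F)"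

definition balanced_fun_set :: "'s set \<Rightarrow> ('s \<Rightarrow> ereal) set \<Rightarrow> bool" where
  "balanced_fun_set S F \<longleftrightarrow> (\<forall>f\<in>F. \<forall>t::real. \<bar>t\<bar> \<le> 1 \<longrightarrow> (\<lambda>s\<in>S. ereal t * f s) \<in> F)"

definition ipm :: "('s \<Rightarrow> ereal) set \<Rightarrow> 's measure \<Rightarrow> 's measure \<Rightarrow> ennreal" where
  "ipm F \<nu>1 \<nu>2 = (SUP f\<in>F. e2ennreal \<bar>eint \<nu>1 f - eint \<nu>2 f\<bar>)"

definition minkowski :: "'s set \<Rightarrow> ('s \<Rightarrow> ereal) set \<Rightarrow> ('s \<Rightarrow> ereal) \<Rightarrow> ennreal" where
  "minkowski S F f = Inf {ennreal r | r. 0 < r \<and> (\<lambda>s\<in>S. f s / ereal r) \<in> F}"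

text \<open>
  Product of a Minkowski functional and a distance. Unlike in \<^typ>\<open>ennreal\<close>, where
  \<open>\<infinity> * 0 = 0\<close>, the product is infinite as soon as one factor is, which is what the lemma
  \<open>eint_diff_le\<close> below requires.
\<close>

definition ext_mult :: "ennreal \<Rightarrow> ennreal \<Rightarrow> ennreal" (infixl \<open>\<odot>\<close> 70) where
  "x \<odot> y = (if x = \<infinity> \<or> y = \<infinity> then \<infinity> else x * y)"

definition eps ::
  "real \<Rightarrow> real \<Rightarrow> ('s \<Rightarrow> real) \<Rightarrow> ('s::polish_space, 'a::polish_space) mdp \<Rightarrow> ('s, 'a) mdp \<Rightarrow>
   ('s \<Rightarrow> 'a measure) \<Rightarrow> ('s \<Rightarrow> 'a measure) \<Rightarrow> ennreal" where
  "eps \<alpha>1 \<alpha>2 w M N \<pi> \<pi>' =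
     wnorm (states M) w (\<lambda>s. ereal \<alpha>1 * cost_pol M \<pi> s + ereal \<alpha>2 - cost_pol N \<pi>' s)"

definition delta ::
  "('s \<Rightarrow> ereal) set \<Rightarrow> ('s \<Rightarrow> real) \<Rightarrow> ('s::polish_space, 'a::polish_space) mdp \<Rightarrow> ('s, 'a) mdp \<Rightarrow>
   ('s \<Rightarrow> 'a measure) \<Rightarrow> ('s \<Rightarrow> 'a measure) \<Rightarrow> ennreal" where
  "delta F w M N \<pi> \<pi>' =
     (SUP s\<in>states M. ipm F (kernel_pol M \<pi> s) (kernel_pol N \<pi>' s) / ennreal (w s))"

definition eps_max ::
  "real \<Rightarrow> real \<Rightarrow> ('s \<Rightarrow> real) \<Rightarrow> ('s::polish_space, 'a::polish_space) mdp \<Rightarrow> ('s, 'a) mdp \<Rightarrow> ennreal"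
where
  "eps_max \<alpha>1 \<alpha>2 w M N =
     (SUP (s, a)\<in>states M \<times> actions M. ennreal (\<bar>\<alpha>1 * cost M (s, a) + \<alpha>2 - cost N (s, a)\<bar> / w s))"

definition delta_max ::
  "('s \<Rightarrow> ereal) set \<Rightarrow> ('s \<Rightarrow> real) \<Rightarrow> ('s::polish_space, 'a::polish_space) mdp \<Rightarrow> ('s, 'a) mdp \<Rightarrow> ennreal"
where
  "delta_max F w M N =
     (SUP (s, a)\<in>states M \<times> actions M. ipm F (kernel M (s, a)) (kernel N (s, a)) / ennreal (w s))"

section \<open>Well-definedness\<close>

lemma is_opt_val_unique:
  assumes "is_opt_val M V" "is_opt_val M V'"
  shows "V = V'"
proof (rule extensionalityI)
  show "V \<in> extensional (states M)" "V' \<in> extensional (states M)"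
    using assms by (auto simp: is_opt_val_def)
  show "V s = V' s" if "s \<in> states M" for s
    using assms that unfolding is_opt_val_def by (metis order_antisym)
qed

lemma is_opt_val_opt_val:
  assumes "dp_solvable cmin w M"
  shows "is_opt_val M (opt_val M)"
  using assms is_opt_val_unique unfolding dp_solvable_def opt_val_def by (metis theI)

lemma sa_law_measurable:
  assumes "is_mdp M" "\<pi> \<in> policies M"
  shows "sa_law M \<pi> \<in> state_space M \<rightarrow>\<^sub>M prob_algebra (sa_space M)"
proof -
  have [measurable]: "\<pi> \<in> state_space M \<rightarrow>\<^sub>M prob_algebra (action_space M)"
    using assms by (simp add: policies_def)
  show ?thesis
    unfolding sa_law_def[abs_def]
    by (rule measurable_bind_prob_space2[where N="action_space M"]) measurable
qed

lemma Ionescu_Tulcea_traj_step: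
  assumes "is_mdp M" "\<pi> \<in> policies M" "s \<in> states M"
  shows "Ionescu_Tulcea (traj_step M \<pi> s) (\<lambda>t. sa_space M)"
proof -
  note [measurable] = sa_law_measurable[OF assms(1,2)]
  have k[measurable]: "kernel M \<in> sa_space M \<rightarrow>\<^sub>M prob_algebra (state_space M)"
    using assms by (simp add: is_mdp_def)
  have s: "s \<in> space (state_space M)"
    using assms(3) by (simp add: space_restrict_space)
  have *: "traj_step M \<pi> s i \<in> PiM {0..<i} (\<lambda>t. sa_space M) \<rightarrow>\<^sub>M prob_algebra (sa_space M)" for i
  proof (cases i)
    case 0
    then show ?thesis
      using s measurable_space[OF sa_law_measurable[OF assms(1,2)] s] by simp
  next
    case (Suc t)
    have "(\<lambda>\<omega>. kernel M (\<omega> t)) \<in> PiM {0..<Suc t} (\<lambda>t. sa_space M) \<rightarrow>\<^sub>M prob_algebra (state_space M)"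
      by (rule measurable_compose[where f="\<lambda>\<omega>. \<omega> t", OF _ k]) (rule measurable_component_singleton, simp)
    then show ?thesis
      unfolding Suc traj_step.simps by (rule measurable_bind_prob_space) measurable
  qed
  show ?thesis
  proof (rule Ionescu_Tulcea.intro)
    show "traj_step M \<pi> s i \<in> PiM {0..<i} (\<lambda>t. sa_space M) \<rightarrow>\<^sub>M subprob_algebra (sa_space M)" for i
      using * by (rule measurable_prob_algebraD)
    show "prob_space (traj_step M \<pi> s i x)" if "x \<in> space (PiM {0..<i} (\<lambda>t. sa_space M))" for i x
      using measurable_space[OF * that] by (simp add: space_prob_algebra)
  qed
qed

lemma eint_divide:
  assumes [measurable]: "f \<in> borel_measurable \<nu>" and r: "0 < r"
  shows "eint \<nu> (\<lambda>x. f x / ereal r) = eint \<nu> f / ereal r"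
proof -
  have e: "e2ennreal (x / ereal r) = e2ennreal x / ennreal r" for x
  proof (cases "0 \<le> x")
    case True
    then show ?thesis
      using r by (cases x) (auto simp: e2ennreal_ereal divide_ennreal ennreal_top_divide e2ennreal_infty)
  next
    case False
    then show ?thesis
      using r by (cases x) (auto simp: ennreal_neg e2ennreal_neg divide_nonpos_pos)
  qed
  have i: "(\<integral>\<^sup>+x. e2ennreal (g x / ereal r) \<partial>\<nu>) = (\<integral>\<^sup>+x. e2ennreal (g x) \<partial>\<nu>) / ennreal r"
    if [measurable]: "g \<in> borel_measurable \<nu>" for g
    unfolding e by (rule nn_integral_divide) measurable
  have d: "enn2ereal (x / ennreal r) = enn2ereal x / ereal r" for x
    using r by (cases x) (auto simp: divide_ennreal ennreal_top_divide enn2ereal_ennreal)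
  have s: "x / ereal r - y / ereal r = (x - y) / ereal r" for x y
    using r by (cases x; cases y) (auto simp: diff_divide_distrib)
  have m: "- (x / ereal r) = (- x) / ereal r" for x
    using r by (cases x) auto
  show ?thesis
    unfolding eint_def m i[OF assms(1)] i[OF borel_measurable_uminus_ereal[OF assms(1)]] d s ..
qed

lemma eint_diff_le:
  assumes f: "f \<in> borel_measurable \<nu>1" "f \<in> borel_measurable \<nu>2"
    and S: "space \<nu>1 = S" "space \<nu>2 = S"
  shows "e2ennreal \<bar>eint \<nu>1 f - eint \<nu>2 f\<bar> \<le> minkowski S F f \<odot> ipm F \<nu>1 \<nu>2"
proof (cases "minkowski S F f = \<infinity> \<or> ipm F \<nu>1 \<nu>2 = \<infinity>")
  case True
  then show ?thesis
    by (simp add: ext_mult_def)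
next
  case False
  define D where "D = e2ennreal \<bar>eint \<nu>1 f - eint \<nu>2 f\<bar>"
  define d where "d = ipm F \<nu>1 \<nu>2"
  have D: "D \<le> ennreal r * d" if r: "0 < r" and F: "(\<lambda>s\<in>S. f s / ereal r) \<in> F" for r
  proof -
    have e: "eint \<nu> (\<lambda>s\<in>S. f s / ereal r) = eint \<nu> f / ereal r"
      if "f \<in> borel_measurable \<nu>" "space \<nu> = S" for \<nu>
    proof -
      have "eint \<nu> (\<lambda>s\<in>S. f s / ereal r) = eint \<nu> (\<lambda>s. f s / ereal r)"
        using that(2) by (auto simp: eint_def intro!: arg_cong2[where f=minus] arg_cong[where f=enn2ereal] nn_integral_cong)
      then show ?thesis
        using that(1) r by (simp add: eint_divide)
    qed
    have g: "x = ereal r * (x / ereal r)" for x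
      using r by (cases x) auto
    have h: "\<bar>x - y\<bar> = ereal r * \<bar>x / ereal r - y / ereal r\<bar>" for x y
      using r by (cases x; cases y) (auto simp: diff_divide_distrib[symmetric] abs_divide)
    have m: "e2ennreal (ereal r * x) = ennreal r * e2ennreal x" if "0 \<le> x" for x
      using that r by (cases x) (auto simp: ennreal_mult ennreal_mult_top)
    have "D = ennreal r * e2ennreal \<bar>eint \<nu>1 f / ereal r - eint \<nu>2 f / ereal r\<bar>"
      unfolding D_def h[of "eint \<nu>1 f"] by (rule m) simp
    also have "\<dots> \<le> ennreal r * d"
      unfolding d_def ipm_def
      by (intro mult_left_mono SUP_upper2[OF F]) (simp_all add: e f S)
    finally show ?thesis .
  qed
  have "D \<le> minkowski S F f * d"
  proof (cases "d = 0")
    case True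
    have "\<exists>r. 0 < r \<and> (\<lambda>s\<in>S. f s / ereal r) \<in> F"
      using False by (auto simp: minkowski_def)
    with D True show ?thesis
      by auto
  next
    case d: False
    have "D / d \<le> minkowski S F f"
      unfolding minkowski_def
    proof (rule Inf_greatest, safe)
      fix r :: real assume "0 < r" "(\<lambda>s\<in>S. f s / ereal r) \<in> F"
      from D[OF this] show "D / d \<le> ennreal r"
        using d False by (intro divide_le_posI_ennreal) (auto simp: d_def mult.commute zero_less_iff_neq_zero)
    qed
    then have "D / d * d \<le> minkowski S F f * d"
      by (rule mult_right_mono) simp
    moreover have "D / d * d = D"
      using d False by (simp add: d_def ennreal_divide_times ennreal_divide_self less_top)
    ultimately show ?thesis
      by simp
  qed
  with False show ?thesis
    by (simp add: ext_mult_def D_def d_def)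
qed

end

theory Submission
  imports Defs
begin

text \<open>
  The bounds are perturbation estimates for fixed points of contractions. Put
  \<open>q = \<gamma>\<kappa> < 1\<close>. On functions that are bounded in the weighted norm, the Bellman operator of a
  \<open>(\<kappa>,w)\<close>-stable policy is a \<open>q\<close>-contraction (\<open>pol_step_contraction\<close>), and the value function of such a
  policy is its fixed point (\<open>val_real\<close>). The trajectory law enters through one formula: since
  costs are bounded below, the value is, up to an additive constant, a series of nonnegative expected
  stage costs. Splitting this series after the first stage gives the fixed point equation
  (\<open>val_eq_excess_value\<close>, \<open>excess_value_step\<close>, \<open>val_fixpoint\<close>).

  Let \<open>A\<close> be the model \<open>M\<close> with cost \<open>\<alpha>1 c + \<alpha>2\<close>. An affine change of the cost induces an affine
  change of all values, so \<open>\<alpha>1 (V - V\<^sup>*)\<close> is the difference of the value \<open>x\<close> of \<open>\<pi>h\<close> in \<open>A\<close> and the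
  optimal value \<open>y\<close> of \<open>A\<close>. Both are compared with the optimal value \<open>z\<close> of \<open>N\<close>.

  \<^item> Centre \<open>z\<close>: \<open>\<bar>x - y\<bar> \<le> \<bar>x - z\<bar> + \<bar>y - z\<bar>\<close>. The operators of \<open>A\<close> move \<open>z\<close>, which the operator of
    \<open>\<pi>h\<close> in \<open>N\<close> fixes, by at most the model gap \<open>\<epsilon> + \<gamma> \<rho>(z) \<delta>\<close>; a contraction turns this residual
    into a distance at the price of a factor \<open>1 / (1 - q)\<close>.
  \<^item> Centre \<open>y\<close>: with \<open>D\<close> the distance of \<open>y\<close> and \<open>z\<close>, the residual of \<open>y\<close> under the operator of \<open>\<pi>h\<close>
    in \<open>A\<close> is at most the model gap at \<open>y\<close> plus \<open>(1 + q) D\<close>, because \<open>N\<close> contracts \<open>\<bar>y - z\<bar>\<close> to \<open>q D\<close>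
    and returns from \<open>z\<close> to \<open>y\<close> at cost \<open>D\<close>; the distance \<open>D\<close> itself is estimated as before.

  To estimate \<open>\<bar>y - z\<bar>\<close>, the lemma \<open>perturbation\<close> inserts between the two models a stable policy that is
  greedy for \<open>z\<close> in \<open>A\<close> or, with the models exchanged, greedy for \<open>y\<close> in \<open>N\<close>: an optimal value lies below
  its image under every stable policy, and the greedy policy has the least image of the other value, so
  the optimal operators contract between these two functions. If all open-loop
  policies are stable, the comparison can be made action by action and then averaged
  (\<open>dist_y_z_open_loop\<close>). Finally \<open>model_gap\<close> bounds the gap between the models by the distances
  \<open>\<epsilon>\<close> and \<open>\<delta>\<close>.
\<close>

section \<open>Extended integrals of functions bounded below\<close>

text \<open>
  The integral of an extended-real function is neither additive nor compatible with kernels in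
  general. For functions bounded below by a constant it is a shifted nonnegative integral
  (\<open>eint_shift\<close>, \<open>eint_eq\<close>), from which the remaining rules follow.
\<close>

lemma eint_cong: "(\<And>x. x \<in> space \<nu> \<Longrightarrow> f x = g x) \<Longrightarrow> eint \<nu> f = eint \<nu> g"
  by (auto simp: eint_def intro!: arg_cong2[where f=minus] arg_cong[where f=enn2ereal] nn_integral_cong)

lemma eint_mono: "(\<And>x. x \<in> space \<nu> \<Longrightarrow> f x \<le> g x) \<Longrightarrow> eint \<nu> f \<le> eint \<nu> g"
  unfolding eint_def
  by (intro ereal_minus_mono) (auto simp flip: less_eq_ennreal.rep_eq intro!: nn_integral_mono e2ennreal_mono)

text \<open>
  The positive part \<open>p\<close> and the negative part \<open>n\<close> of \<open>G + \<beta>\<close> satisfy \<open>p + \<beta>\<^sup>- = G + n + \<beta>\<^sup>+\<close>, an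
  identity between nonnegative functions that can be integrated; \<open>n\<close> is bounded by \<open>\<beta>\<^sup>-\<close>, hence has a
  finite integral and may be subtracted.
\<close>

lemma eint_shift:
  assumes "prob_space \<nu>" and [measurable]: "G \<in> borel_measurable \<nu>"
  shows "eint \<nu> (\<lambda>x. enn2ereal (G x) + ereal \<beta>) = enn2ereal (\<integral>\<^sup>+x. G x \<partial>\<nu>) + ereal \<beta>"
proof -
  interpret prob_space \<nu> by fact
  let ?p = "\<lambda>x. e2ennreal (enn2ereal (G x) + ereal \<beta>)"
  let ?n = "\<lambda>x. e2ennreal (- (enn2ereal (G x) + ereal \<beta>))"
  have eq: "?p x + ennreal (- \<beta>) = G x + ?n x + ennreal \<beta>" for x
  proof (cases "G x" rule: ennreal_cases)
    case (real r)
    have "ennreal (r + \<beta>) + ennreal (- \<beta>) = ennreal r + ennreal (- (r + \<beta>)) + ennreal \<beta>"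
    proof -
      consider "0 \<le> \<beta>" | "\<beta> < 0" "0 \<le> r + \<beta>" | "\<beta> < 0" "r + \<beta> < 0"
        by linarith
      then show ?thesis
      proof cases
        case 1
        then have "ennreal (- \<beta>) = 0" "ennreal (- (r + \<beta>)) = 0"
          using real by (auto intro!: ennreal_neg)
        then show ?thesis
          using real 1 by (simp only: ennreal_plus add_0_right)
      next
        case 2
        then have "ennreal \<beta> = 0" "ennreal (- (r + \<beta>)) = 0"
          by (auto intro!: ennreal_neg)
        moreover have "ennreal (r + \<beta>) + ennreal (- \<beta>) = ennreal r"
          using ennreal_plus[of "r + \<beta>" "- \<beta>"] 2 by simp
        ultimately show ?thesis
          by (simp only: add_0_right)
      next
        case 3
        then have "ennreal \<beta> = 0" "ennreal (r + \<beta>) = 0"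
          by (auto intro!: ennreal_neg)
        moreover have "ennreal (- \<beta>) = ennreal (r + - (r + \<beta>))"
          by simp
        moreover have "\<dots> = ennreal r + ennreal (- (r + \<beta>))"
          using real 3 by (intro ennreal_plus) auto
        ultimately show ?thesis
          by (simp only: add_0_right add_0_left)
      qed
    qed
    then show ?thesis
      using real by simp
  qed (auto simp: e2ennreal_neg)
  have n_le: "?n x \<le> ennreal (- \<beta>)" for x
    by (cases "G x" rule: ennreal_cases) (auto simp: enn2ereal_ennreal e2ennreal_ereal e2ennreal_neg intro: ennreal_leI)
  have "(\<integral>\<^sup>+x. ?n x \<partial>\<nu>) \<le> (\<integral>\<^sup>+x. ennreal (- \<beta>) \<partial>\<nu>)"
    by (intro nn_integral_mono n_le)
  then have fin: "(\<integral>\<^sup>+x. ?n x \<partial>\<nu>) \<le> ennreal (- \<beta>)"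
    by (simp add: emeasure_space_1)
  have "(\<integral>\<^sup>+x. ?p x + ennreal (- \<beta>) \<partial>\<nu>) = (\<integral>\<^sup>+x. G x + ?n x + ennreal \<beta> \<partial>\<nu>)"
    by (simp add: eq)
  then have *: "(\<integral>\<^sup>+x. ?p x \<partial>\<nu>) + ennreal (- \<beta>) = (\<integral>\<^sup>+x. G x \<partial>\<nu>) + (\<integral>\<^sup>+x. ?n x \<partial>\<nu>) + ennreal \<beta>"
    by (simp add: nn_integral_add emeasure_space_1)
  obtain n where n: "0 \<le> n" "(\<integral>\<^sup>+x. ?n x \<partial>\<nu>) = ennreal n"
    using fin by (metis ennreal_cases ennreal_less_top leD top.extremum_unique order_le_less_trans)
  show ?thesis
  proof (cases "\<integral>\<^sup>+x. G x \<partial>\<nu>" rule: ennreal_cases)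
    case (real g)
    with * n have "(\<integral>\<^sup>+x. ?p x \<partial>\<nu>) \<noteq> \<infinity>"
      by (metis ennreal_add_eq_top ennreal_neq_top infinity_ennreal_def)
    then obtain p where p: "0 \<le> p" "(\<integral>\<^sup>+x. ?p x \<partial>\<nu>) = ennreal p"
      by (metis ennreal_cases infinity_ennreal_def)
    have "p + max 0 (- \<beta>) = g + n + max 0 \<beta>"
    proof -
      have pm: "ennreal (max 0 b) = ennreal b" for b
        by (simp add: max_def ennreal_neg)
      have "ennreal (p + max 0 (- \<beta>)) = ennreal p + ennreal (- \<beta>)"
        using p(1) by (subst ennreal_plus) (simp_all only: pm max.cobounded1)
      also have "\<dots> = ennreal g + ennreal n + ennreal \<beta>"
        using * by (simp only: p real n)
      also have "\<dots> = ennreal (g + n + max 0 \<beta>)"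
        using n(1) real by (subst ennreal_plus) (simp_all add: pm)
      finally have "ennreal (p + max 0 (- \<beta>)) = ennreal (g + n + max 0 \<beta>)" .
      then show ?thesis
        using p(1) n(1) real by (subst (asm) ennreal_inj) auto
    qed
    then have "p - n = g + \<beta>"
      by (auto simp: max_def split: if_splits)
    then show ?thesis
      by (simp add: eint_def p n real enn2ereal_ennreal)
  next
    case top
    with * n have "(\<integral>\<^sup>+x. ?p x \<partial>\<nu>) = \<infinity>"
      by (metis ennreal_add_eq_top ennreal_neq_top infinity_ennreal_def top_add)
    then show ?thesis by (simp add: eint_def n top enn2ereal_ennreal)
  qed
qed

lemma shift_ereal: "ereal \<beta> \<le> x \<Longrightarrow> x = enn2ereal (e2ennreal (x - ereal \<beta>)) + ereal \<beta>"
  by (cases x) (auto simp: e2ennreal_ereal enn2ereal_ennreal e2ennreal_infty)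

lemma eint_eq:
  assumes "prob_space \<nu>" and [measurable]: "f \<in> borel_measurable \<nu>"
    and "\<And>x. x \<in> space \<nu> \<Longrightarrow> ereal \<beta> \<le> f x"
  shows "eint \<nu> f = enn2ereal (\<integral>\<^sup>+x. e2ennreal (f x - ereal \<beta>) \<partial>\<nu>) + ereal \<beta>"
proof -
  have "eint \<nu> f = eint \<nu> (\<lambda>x. enn2ereal (e2ennreal (f x - ereal \<beta>)) + ereal \<beta>)"
    by (intro eint_cong shift_ereal assms)
  then show ?thesis
    using assms(1) by (simp add: eint_shift)
qed

lemma pos_part_minus_neg_part: "enn2ereal (e2ennreal x) - enn2ereal (e2ennreal (- x)) = x"
proof (cases "0 \<le> x")
  case True
  then show ?thesis
    by (simp add: enn2ereal_e2ennreal e2ennreal_neg zero_ennreal.rep_eq)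
next
  case False
  then have "x \<le> 0" "0 \<le> - x"
    by (auto simp: ereal_0_le_uminus_iff)
  then show ?thesis
    by (simp add: enn2ereal_e2ennreal e2ennreal_neg zero_ennreal.rep_eq)
qed

lemma eint_const: "prob_space \<nu> \<Longrightarrow> eint \<nu> (\<lambda>x. c) = c"
  by (simp add: eint_def prob_space.emeasure_space_1 pos_part_minus_neg_part)

lemma eint_real:
  assumes "integrable \<nu> u"
  shows "eint \<nu> (\<lambda>x. ereal (u x)) = ereal (\<integral>x. u x \<partial>\<nu>)"
proof -
  have "(\<integral>\<^sup>+x. ennreal (u x) \<partial>\<nu>) < \<infinity>" "(\<integral>\<^sup>+x. ennreal (- u x) \<partial>\<nu>) < \<infinity>"
    using assms by (auto simp: real_integrable_def top.not_eq_extremum)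
  then obtain p n where "0 \<le> p" "(\<integral>\<^sup>+x. ennreal (u x) \<partial>\<nu>) = ennreal p"
    "0 \<le> n" "(\<integral>\<^sup>+x. ennreal (- u x) \<partial>\<nu>) = ennreal n"
    by (metis ennreal_cases infinity_ennreal_def less_irrefl)
  then show ?thesis
    by (simp add: eint_def real_lebesgue_integral_def[OF assms] e2ennreal_ereal enn2ereal_ennreal)
qed

lemma eint_add:
  assumes "prob_space \<nu>" and [measurable]: "f \<in> borel_measurable \<nu>" "g \<in> borel_measurable \<nu>"
    and f: "\<And>x. x \<in> space \<nu> \<Longrightarrow> ereal \<beta> \<le> f x" and g: "\<And>x. x \<in> space \<nu> \<Longrightarrow> ereal \<beta>' \<le> g x"
  shows "eint \<nu> (\<lambda>x. f x + g x) = eint \<nu> f + eint \<nu> g"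
proof -
  have "eint \<nu> (\<lambda>x. f x + g x) =
      eint \<nu> (\<lambda>x. enn2ereal (e2ennreal (f x - ereal \<beta>) + e2ennreal (g x - ereal \<beta>')) + ereal (\<beta> + \<beta>'))"
  proof (rule eint_cong)
    fix x assume "x \<in> space \<nu>"
    from f[OF this] g[OF this]
    show "f x + g x = enn2ereal (e2ennreal (f x - ereal \<beta>) + e2ennreal (g x - ereal \<beta>')) + ereal (\<beta> + \<beta>')"
      by (cases "f x"; cases "g x")
        (auto simp: e2ennreal_ereal enn2ereal_ennreal e2ennreal_infty plus_ennreal.rep_eq)
  qed
  also have "\<dots> = eint \<nu> f + eint \<nu> g"
    using assms(1) 
    by (subst eint_shift)
      (simp_all add: nn_integral_add eint_eq[OF _ _ f] eint_eq[OF _ _ g] plus_ennreal.rep_eq ac_simps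
        flip: plus_ereal.simps(1))
  finally show ?thesis .
qed

lemma eint_cmult:
  assumes [measurable]: "f \<in> borel_measurable \<nu>" and r: "0 < r"
  shows "eint \<nu> (\<lambda>x. ereal r * f x) = ereal r * eint \<nu> f"
proof -
  have d: "x / ereal (1 / r) = ereal r * x" for x
    using r by (cases x) auto
  show ?thesis
    using eint_divide[OF assms(1), of "1 / r"] r by (simp add: d)
qed

lemma eint_return:
  assumes "x \<in> space L" and [measurable]: "f \<in> borel_measurable L"
  shows "eint (return L x) f = f x"
proof -
  have "eint (return L x) f = enn2ereal (e2ennreal (f x)) - enn2ereal (e2ennreal (- f x))"
    using assms by (simp add: eint_def nn_integral_return)
  then show ?thesis
    by (simp add: pos_part_minus_neg_part)
qed

lemma eint_bind:
  assumes A: "A \<in> space (prob_algebra L)" and B: "B \<in> L \<rightarrow>\<^sub>M prob_algebra L'"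
    and [measurable]: "f \<in> borel_measurable L'"
    and f: "\<And>x. x \<in> space L' \<Longrightarrow> ereal \<beta> \<le> f x"
  shows "eint (A \<bind> B) f = eint A (\<lambda>a. eint (B a) f)"
proof -
  have sA[measurable_cong]: "sets A = sets L" and pA: "prob_space A"
    using A by (auto simp: space_prob_algebra)
  have B': "B \<in> A \<rightarrow>\<^sub>M prob_algebra L'"
    using B by (simp cong: measurable_cong_sets add: sA)
  note [measurable] = measurable_prob_algebraD[OF B']
  have sB: "sets (B a) = sets L'" "prob_space (B a)" if "a \<in> space A" for a
    using measurable_space[OF B' that] by (auto simp: space_prob_algebra)
  have AB: "A \<bind> B \<in> space (prob_algebra L')"
    using measurable_space[OF measurable_bind_prob_space[OF measurable_const[OF A] B],
        of undefined "count_space UNIV"] by simp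
  then have pAB: "prob_space (A \<bind> B)" and sAB: "sets (A \<bind> B) = sets L'"
    by (auto simp: space_prob_algebra)
  have "eint (A \<bind> B) f = enn2ereal (\<integral>\<^sup>+x. e2ennreal (f x - ereal \<beta>) \<partial>(A \<bind> B)) + ereal \<beta>"
    using sAB f by (intro eint_eq[OF pAB]) (auto cong: measurable_cong_sets simp: sets_eq_imp_space_eq[OF sAB])
  also have "\<dots> = enn2ereal (\<integral>\<^sup>+a. \<integral>\<^sup>+x. e2ennreal (f x - ereal \<beta>) \<partial>B a \<partial>A) + ereal \<beta>"
    by (subst nn_integral_bind[where B=L']) auto
  also have "\<dots> = eint A (\<lambda>a. enn2ereal (\<integral>\<^sup>+x. e2ennreal (f x - ereal \<beta>) \<partial>B a) + ereal \<beta>)"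
    by (intro eint_shift[symmetric] pA) measurable
  also have "\<dots> = eint A (\<lambda>a. eint (B a) f)"
  proof (rule eint_cong)
    fix a assume a: "a \<in> space A"
    show "enn2ereal (\<integral>\<^sup>+x. e2ennreal (f x - ereal \<beta>) \<partial>B a) + ereal \<beta> = eint (B a) f"
      using sB[OF a] f by (intro eint_eq[symmetric])
        (auto cong: measurable_cong_sets simp: sets_eq_imp_space_eq[OF sB(1)[OF a]])
  qed
  finally show ?thesis .
qed

lemma borel_measurable_eint:
  assumes "B \<in> L \<rightarrow>\<^sub>M prob_algebra L'" and [measurable]: "f \<in> borel_measurable L'"
  shows "(\<lambda>a. eint (B a) f) \<in> borel_measurable L"
proof -
  note [measurable] = measurable_prob_algebraD[OF assms(1)]
  show ?thesis unfolding eint_def by measurable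
qed

text \<open>
  A stability condition bounds the integral of the weight \<open>w\<close>, an arbitrary function whose
  integral is only a supremum over simple functions below it. The constant is therefore moved to the
  measurable function: \<open>u / C\<close> is compared with \<open>w\<close>, and only \<open>u\<close> is rescaled.
\<close>

lemma nn_integral_le_weight:
  assumes [measurable]: "u \<in> borel_measurable \<nu>" and "0 \<le> C" "0 \<le> L"
    and u: "\<And>x. x \<in> space \<nu> \<Longrightarrow> u x \<le> ennreal (C * w x)"
    and w: "(\<integral>\<^sup>+x. ennreal (w x) \<partial>\<nu>) \<le> ennreal L"
  shows "(\<integral>\<^sup>+x. u x \<partial>\<nu>) \<le> ennreal (C * L)"
proof (cases "C = 0")
  case True
  then have "(\<integral>\<^sup>+x. u x \<partial>\<nu>) = (\<integral>\<^sup>+x. 0 \<partial>\<nu>)"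
    using u by (intro nn_integral_cong) auto
  then show ?thesis by simp
next
  case False
  with \<open>0 \<le> C\<close> have C: "0 < C" by simp
  have div: "u x = ennreal C * (u x / ennreal C)" for x
    using C by (metis ennreal_mult_divide_eq ennreal_neq_top ennreal_eq_0_iff ennreal_times_divide
        mult.commute not_le)
  have "(\<integral>\<^sup>+x. u x \<partial>\<nu>) = ennreal C * (\<integral>\<^sup>+x. u x / ennreal C \<partial>\<nu>)"
    by (subst div, subst nn_integral_cmult) auto
  also have "\<dots> \<le> ennreal C * (\<integral>\<^sup>+x. ennreal (w x) \<partial>\<nu>)"
  proof (intro mult_left_mono nn_integral_mono)
    fix x assume "x \<in> space \<nu>"
    from u[OF this] show "u x / ennreal C \<le> ennreal (w x)"
      using C by (intro divide_le_posI_ennreal) (auto simp: ennreal_mult' mult.commute)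
  qed simp
  also have "\<dots> \<le> ennreal C * ennreal L"
    by (intro mult_left_mono w) simp
  finally show ?thesis
    using assms by (simp add: ennreal_mult)
qed

section \<open>One-dimensional marginals of the trajectory law\<close>

lemma space_state_space [simp]: "space (state_space M) = states M"
  by (simp add: space_restrict_space)

lemma space_action_space [simp]: "space (action_space M) = actions M"
  by (simp add: space_restrict_space)

lemma (in Ionescu_Tulcea) nn_integral_lim_prefix:
  assumes [measurable]: "f \<in> borel_measurable (PiM {0..<n} M)"
  shows "(\<integral>\<^sup>+\<omega>. f (restrict \<omega> {0..<n}) \<partial>PF.lim) = (\<integral>\<^sup>+x. f x \<partial>C 0 n (\<lambda>_. undefined))"
proof -
  have u: "up_to {0..<n} = n"
    using up_to[of "{0..<n}"] by (intro antisym) (auto simp: up_to_iff_Ico)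
  have "C 0 n (\<lambda>_. undefined) = CI {0..<n}"
    using distr_C[of n n "\<lambda>_. undefined" 0] by (simp add: CI_def u)
  also have "\<dots> = distr PF.lim (PiM {0..<n} M) (\<lambda>\<omega>. restrict \<omega> {0..<n})"
    by (simp add: distr_lim)
  finally show ?thesis
    by (simp add: nn_integral_distr measurable_cong_sets[OF PF.sets_lim])
qed

lemma (in Ionescu_Tulcea) prob_space_lim: "prob_space PF.lim"
proof
  have "emeasure PF.lim (space PF.lim) = (\<integral>\<^sup>+\<omega>. 1 \<partial>PF.lim)"
    by simp
  also have "\<dots> = 1"
    using nn_integral_lim_prefix[of "\<lambda>_. 1" 0] prob_space.emeasure_space_1[OF prob_space_C[of "\<lambda>_. undefined" 0 0]]
    by simp
  finally show "emeasure PF.lim (space PF.lim) = 1" .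
qed

text \<open>
  The coordinate at time \<open>t\<close> is drawn from the step kernel \<open>P t\<close> applied to the first \<open>t\<close> coordinates:
  integrate the last coordinate of the law of the first \<open>t + 1\<close> ones.
\<close>

lemma (in Ionescu_Tulcea) nn_integral_lim_component:
  assumes g: "g \<in> borel_measurable (M t)"
  shows "(\<integral>\<^sup>+\<omega>. g (\<omega> t) \<partial>PF.lim) = (\<integral>\<^sup>+\<omega>. (\<integral>\<^sup>+x. g x \<partial>P t (restrict \<omega> {0..<t})) \<partial>PF.lim)"
proof -
  note [measurable] = g
  have "(\<integral>\<^sup>+\<omega>. g (\<omega> t) \<partial>PF.lim) = (\<integral>\<^sup>+\<omega>. g (restrict \<omega> {0..<Suc t} t) \<partial>PF.lim)"
    by simp
  also have "\<dots> = (\<integral>\<^sup>+x. g (x t) \<partial>C 0 (Suc t) (\<lambda>_. undefined))"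
    by (rule nn_integral_lim_prefix) measurable
  also have "\<dots> = (\<integral>\<^sup>+y. (\<integral>\<^sup>+x. g (x t) \<partial>eP t y) \<partial>C 0 t (\<lambda>_. undefined))"
    by (simp, subst nn_integral_bind[where B="PiM {0..<Suc t} M"])
      (auto cong: measurable_cong_sets simp: sets_C)
  also have "\<dots> = (\<integral>\<^sup>+y. (\<integral>\<^sup>+x. g x \<partial>P t y) \<partial>C 0 t (\<lambda>_. undefined))"
    by (intro nn_integral_cong) (simp add: space_C nn_integral_eP)
  also have "\<dots> = (\<integral>\<^sup>+\<omega>. (\<integral>\<^sup>+x. g x \<partial>P t (restrict \<omega> {0..<t})) \<partial>PF.lim)"
    by (rule nn_integral_lim_prefix[symmetric]) measurable
  finally show ?thesis .
qed

text \<open>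
  The expectation of \<open>g\<close> at the \<open>t\<close>-th stage, computed backwards: the policy \<open>\<pi>\<close> is integrated once,
  then the state kernel \<open>K\<close> is applied \<open>t\<close> times. Since \<open>K\<close> is a parameter, two models with the same
  state kernel have literally the same stage costs.
\<close>

primrec stage_cost ::
  "('s \<Rightarrow> 'a measure) \<Rightarrow> ('s \<Rightarrow> 's measure) \<Rightarrow> ('s \<times> 'a \<Rightarrow> ennreal) \<Rightarrow> nat \<Rightarrow> 's \<Rightarrow> ennreal" where
  "stage_cost \<pi> K g 0 s = (\<integral>\<^sup>+a. g (s, a) \<partial>\<pi> s)"
| "stage_cost \<pi> K g (Suc t) s = (\<integral>\<^sup>+s'. stage_cost \<pi> K g t s' \<partial>K s)"

locale markov_model =
  fixes M :: "('s::polish_space, 'a::polish_space) mdp"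
  assumes is_mdp: "is_mdp M"
begin

lemma disc_pos: "0 < disc M" and disc_less_1: "disc M < 1"
  using is_mdp by (auto simp: is_mdp_def)

lemma measurable_kernel [measurable]: "kernel M \<in> sa_space M \<rightarrow>\<^sub>M prob_algebra (state_space M)"
  using is_mdp by (simp add: is_mdp_def)

lemma measurable_cost [measurable]: "cost M \<in> borel_measurable (sa_space M)"
  using is_mdp by (simp add: is_mdp_def)

lemma kernel_in [intro]:
  "s \<in> states M \<Longrightarrow> a \<in> actions M \<Longrightarrow> kernel M (s, a) \<in> space (prob_algebra (state_space M))"
  using measurable_space[OF measurable_kernel, of "(s, a)"] by (simp add: space_pair_measure)

lemma measurable_kernel_action:
  "s \<in> states M \<Longrightarrow> (\<lambda>a. kernel M (s, a)) \<in> action_space M \<rightarrow>\<^sub>M prob_algebra (state_space M)"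
  by measurable

lemma measurable_cost_action:
  "s \<in> states M \<Longrightarrow> (\<lambda>a. cost M (s, a)) \<in> borel_measurable (action_space M)"
  by measurable

context
  fixes \<pi> assumes \<pi>: "\<pi> \<in> policies M"
begin

lemma measurable_policy [measurable]: "\<pi> \<in> state_space M \<rightarrow>\<^sub>M prob_algebra (action_space M)"
  using \<pi> by (simp add: policies_def)

lemma policy_in: "s \<in> states M \<Longrightarrow> \<pi> s \<in> space (prob_algebra (action_space M))"
  using measurable_space[OF measurable_policy, of s] by simp

lemma policy_simps:
  assumes "s \<in> states M"
  shows "prob_space (\<pi> s)" "sets (\<pi> s) = sets (action_space M)" "space (\<pi> s) = actions M"
  using policy_in[OF assms] by (auto simp: space_prob_algebra dest: sets_eq_imp_space_eq)

lemma measurable_kernel_pol [measurable]: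
  "kernel_pol M \<pi> \<in> state_space M \<rightarrow>\<^sub>M prob_algebra (state_space M)"
  unfolding kernel_pol_def[abs_def]
  by (rule measurable_bind_prob_space2[where N="action_space M"]) measurable

lemma kernel_pol_in: "s \<in> states M \<Longrightarrow> kernel_pol M \<pi> s \<in> space (prob_algebra (state_space M))"
  using measurable_space[OF measurable_kernel_pol, of s] by simp

lemma kernel_pol_simps:
  assumes "s \<in> states M"
  shows "prob_space (kernel_pol M \<pi> s)" "sets (kernel_pol M \<pi> s) = sets (state_space M)"
    "space (kernel_pol M \<pi> s) = states M"
  using kernel_pol_in[OF assms] by (auto simp: space_prob_algebra dest: sets_eq_imp_space_eq)

lemma nn_integral_kernel_pol:
  assumes "s \<in> states M" "u \<in> borel_measurable (state_space M)"
  shows "(\<integral>\<^sup>+s'. u s' \<partial>kernel_pol M \<pi> s) = (\<integral>\<^sup>+a. (\<integral>\<^sup>+s'. u s' \<partial>kernel M (s, a)) \<partial>\<pi> s)"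
  unfolding kernel_pol_def
  using policy_simps[OF assms(1)] measurable_prob_algebraD[OF measurable_kernel_action[OF assms(1)]] assms(2)
  by (intro nn_integral_bind[where B="state_space M"]) (auto cong: measurable_cong_sets)

lemma nn_integral_sa_law:
  assumes s: "s \<in> states M" and g[measurable]: "g \<in> borel_measurable (sa_space M)"
  shows "(\<integral>\<^sup>+x. g x \<partial>sa_law M \<pi> s) = (\<integral>\<^sup>+a. g (s, a) \<partial>\<pi> s)"
proof -
  note [measurable_cong] = policy_simps(2)[OF s]
  have [measurable]: "s \<in> space (state_space M)"
    using s by simp
  have "(\<integral>\<^sup>+x. g x \<partial>sa_law M \<pi> s) = (\<integral>\<^sup>+a. (\<integral>\<^sup>+x. g x \<partial>return (sa_space M) (s, a)) \<partial>\<pi> s)"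
    unfolding sa_law_def by (rule nn_integral_bind[where B="sa_space M"]) measurable
  also have "\<dots> = (\<integral>\<^sup>+a. g (s, a) \<partial>\<pi> s)"
    using s policy_simps(3)[OF s] by (intro nn_integral_cong nn_integral_return) (auto simp: space_pair_measure)
  finally show ?thesis .
qed

lemma measurable_stage_cost [measurable]:
  assumes [measurable]: "g \<in> borel_measurable (sa_space M)"
  shows "stage_cost \<pi> (kernel_pol M \<pi>) g t \<in> borel_measurable (state_space M)"
proof (induction t)
  case 0
  note [measurable] = measurable_prob_algebraD[OF measurable_policy]
  show ?case
    unfolding stage_cost.simps[abs_def] by (rule nn_integral_measurable_subprob_algebra2) measurable
next
  case (Suc t)
  note [measurable] = measurable_prob_algebraD[OF measurable_kernel_pol] Suc
  show ?case
    unfolding stage_cost.simps[abs_def] by measurable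
qed

text \<open>
  Two backward recursions that agree at some stages \<open>i\<close> and \<open>j\<close> agree from there on. It is applied
  with \<open>i = 0\<close> and \<open>j = 1\<close>, to absorb one transition into the function that is averaged.
\<close>

lemma stage_cost_cong:
  assumes "\<And>s. s \<in> states M \<Longrightarrow> stage_cost \<pi> (kernel_pol M \<pi>) g i s = stage_cost \<pi> (kernel_pol M \<pi>) h j s"
    and "s \<in> states M"
  shows "stage_cost \<pi> (kernel_pol M \<pi>) g (i + t) s = stage_cost \<pi> (kernel_pol M \<pi>) h (j + t) s"
  using assms(2)
  by (induction t arbitrary: s) (auto simp: assms(1) kernel_pol_simps intro!: nn_integral_cong)

text \<open>
  Backward and forward evolution agree. The pair at time \<open>t + 1\<close> is drawn from the pair at time \<open>t\<close>,
  so the expectation of \<open>g\<close> at time \<open>t + 1\<close> is the expectation at time \<open>t\<close> of the one-step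
  prediction \<open>h\<close> of \<open>g\<close>; the induction hypothesis is used for \<open>h\<close>.
\<close>

lemma nn_integral_traj_component:
  assumes s: "s \<in> states M" and "g \<in> borel_measurable (sa_space M)"
  shows "(\<integral>\<^sup>+\<omega>. g (\<omega> t) \<partial>traj M \<pi> s) = stage_cost \<pi> (kernel_pol M \<pi>) g t s"
  using assms(2)
proof (induction t arbitrary: g)
  case (0 g)
  interpret Ionescu_Tulcea "traj_step M \<pi> s" "\<lambda>t. sa_space M"
    by (rule Ionescu_Tulcea_traj_step[OF is_mdp \<pi> s])
  have "(\<integral>\<^sup>+\<omega>. g (\<omega> 0) \<partial>traj M \<pi> s) = (\<integral>\<^sup>+\<omega>. (\<integral>\<^sup>+x. g x \<partial>sa_law M \<pi> s) \<partial>PF.lim)"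
    using nn_integral_lim_component[OF 0] by (simp add: traj_def)
  also have "\<dots> = (\<integral>\<^sup>+x. g x \<partial>sa_law M \<pi> s)"
    by (simp add: prob_space.emeasure_space_1[OF prob_space_lim] del: PF.space_lim)
  finally show ?case
    by (simp add: nn_integral_sa_law[OF s 0])
next
  case (Suc t g)
  note [measurable] = Suc.prems
  interpret Ionescu_Tulcea "traj_step M \<pi> s" "\<lambda>t. sa_space M"
    by (rule Ionescu_Tulcea_traj_step[OF is_mdp \<pi> s])
  define h where "h x = (\<integral>\<^sup>+s'. stage_cost \<pi> (kernel_pol M \<pi>) g 0 s' \<partial>kernel M x)" for x
  note [measurable] = measurable_prob_algebraD[OF measurable_kernel]
  have h: "h \<in> borel_measurable (sa_space M)"
    unfolding h_def[abs_def] by measurable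
  have "(\<integral>\<^sup>+\<omega>. g (\<omega> (Suc t)) \<partial>traj M \<pi> s) =
      (\<integral>\<^sup>+\<omega>. (\<integral>\<^sup>+x. g x \<partial>(kernel M (\<omega> t) \<bind> sa_law M \<pi>)) \<partial>traj M \<pi> s)"
    using nn_integral_lim_component[OF Suc.prems, of "Suc t"] by (simp add: traj_def)
  also have "\<dots> = (\<integral>\<^sup>+\<omega>. h (\<omega> t) \<partial>traj M \<pi> s)"
  proof (rule nn_integral_cong)
    fix \<omega> assume "\<omega> \<in> space (traj M \<pi> s)"
    then have "\<omega> t \<in> space (sa_space M)"
      by (auto simp: traj_def space_PiM)
    then obtain s' a where sa: "\<omega> t = (s', a)" "s' \<in> states M" "a \<in> actions M"
      by (auto simp: space_pair_measure)
    have k: "sets (kernel M (s', a)) = sets (state_space M)" "space (kernel M (s', a)) = states M"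
      using kernel_in[OF sa(2,3)] by (auto simp: space_prob_algebra dest: sets_eq_imp_space_eq)
    note [measurable] = measurable_prob_algebraD[OF sa_law_measurable[OF is_mdp \<pi>]]
    note [measurable_cong] = k(1)
    have "(\<integral>\<^sup>+x. g x \<partial>(kernel M (s', a) \<bind> sa_law M \<pi>)) = (\<integral>\<^sup>+y. (\<integral>\<^sup>+x. g x \<partial>sa_law M \<pi> y) \<partial>kernel M (s', a))"
      by (rule nn_integral_bind[where B="sa_space M"]) measurable
    also have "\<dots> = h (s', a)"
      unfolding h_def using k by (intro nn_integral_cong) (simp add: nn_integral_sa_law)
    finally show "(\<integral>\<^sup>+x. g x \<partial>(kernel M (\<omega> t) \<bind> sa_law M \<pi>)) = h (\<omega> t)"
      by (simp add: sa)
  qed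
  also have "\<dots> = stage_cost \<pi> (kernel_pol M \<pi>) h t s"
    by (rule Suc.IH[OF h])
  also have "\<dots> = stage_cost \<pi> (kernel_pol M \<pi>) g (Suc t) s"
  proof -
    have "stage_cost \<pi> (kernel_pol M \<pi>) h (0 + t) s = stage_cost \<pi> (kernel_pol M \<pi>) g (1 + t) s"
    proof (rule stage_cost_cong[OF _ s])
      fix s' assume "s' \<in> states M"
      then show "stage_cost \<pi> (kernel_pol M \<pi>) h 0 s' = stage_cost \<pi> (kernel_pol M \<pi>) g 1 s'"
        using nn_integral_kernel_pol[OF _ measurable_stage_cost[OF Suc.prems, of 0]] by (simp add: h_def)
    qed
    then show ?thesis by simp
  qed
  finally show ?case .
qed

end

section \<open>Value functions as series of stage costs\<close>

text \<open>
  The discounted value for the nonnegative cost \<open>c - b\<close>, where \<open>b\<close> is a lower bound of \<open>c\<close>. It may be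
  infinite, and sums and integrals can be exchanged freely.
\<close>

definition excess_value :: "('s \<Rightarrow> 'a measure) \<Rightarrow> real \<Rightarrow> 's \<Rightarrow> ennreal" where
  "excess_value \<pi> b s =
     (\<Sum>t. ennreal (disc M ^ t) * stage_cost \<pi> (kernel_pol M \<pi>) (\<lambda>x. ennreal (cost M x - b)) t s)"

lemma discounted_sum_shift:
  assumes "\<And>t. b \<le> x t"
  shows "(\<Sum>t. ereal (disc M ^ t * x t)) =
    enn2ereal (\<Sum>t. ennreal (disc M ^ t * (x t - b))) + ereal (b / (1 - disc M))"
proof -
  let ?\<gamma> = "disc M"
  have pos: "0 \<le> ?\<gamma> ^ t * (x t - b)" for t
    using assms disc_pos by simp
  have "(\<lambda>t. enn2ereal (ennreal (?\<gamma> ^ t * (x t - b)))) sums enn2ereal (\<Sum>t. ennreal (?\<gamma> ^ t * (x t - b)))"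
    unfolding sums_enn2ereal by (simp add: summable_sums)
  then have 1: "(\<lambda>t. ereal (?\<gamma> ^ t * (x t - b))) sums enn2ereal (\<Sum>t. ennreal (?\<gamma> ^ t * (x t - b)))"
    using pos by simp
  have "(\<lambda>t. ?\<gamma> ^ t * b) sums (1 / (1 - ?\<gamma>) * b)"
    using disc_pos disc_less_1 by (intro sums_mult2 geometric_sums) simp
  then have 2: "(\<lambda>t. ereal (?\<gamma> ^ t * b)) sums ereal (b / (1 - ?\<gamma>))"
    by (simp add: sums_ereal)
  have "(\<lambda>t. ereal (?\<gamma> ^ t * (x t - b)) + ereal (?\<gamma> ^ t * b)) sums
      (enn2ereal (\<Sum>t. ennreal (?\<gamma> ^ t * (x t - b))) + ereal (b / (1 - ?\<gamma>)))"
    using 1 2 unfolding sums_def sum.distrib by (intro tendsto_add_ereal_general) auto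
  moreover have "ereal (?\<gamma> ^ t * (x t - b)) + ereal (?\<gamma> ^ t * b) = ereal (?\<gamma> ^ t * x t)" for t
    by (simp add: algebra_simps)
  ultimately show ?thesis
    by (simp only: sums_iff)
qed

lemma val_eq_excess_value:
  assumes b: "\<forall>x\<in>states M \<times> actions M. b \<le> cost M x"
    and \<pi>: "\<pi> \<in> policies M" and s: "s \<in> states M"
  shows "val M \<pi> s = enn2ereal (excess_value \<pi> b s) + ereal (b / (1 - disc M))"
proof -
  interpret Ionescu_Tulcea "traj_step M \<pi> s" "\<lambda>t. sa_space M"
    by (rule Ionescu_Tulcea_traj_step[OF is_mdp \<pi> s])
  have prob: "prob_space (traj M \<pi> s)"
    unfolding traj_def by (rule prob_space_lim)
  have [measurable_cong]: "sets (traj M \<pi> s) = sets (PiM UNIV (\<lambda>t. sa_space M))"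
    by (simp add: traj_def)
  have "val M \<pi> s = eint (traj M \<pi> s)
      (\<lambda>\<omega>. enn2ereal (\<Sum>t. ennreal (disc M ^ t * (cost M (\<omega> t) - b))) + ereal (b / (1 - disc M)))"
    unfolding val_def using s
    by (auto intro!: eint_cong discounted_sum_shift b[rule_format]
        simp: traj_def space_PiM space_pair_measure PiE_iff)
  also have "\<dots> = enn2ereal (\<integral>\<^sup>+\<omega>. (\<Sum>t. ennreal (disc M ^ t * (cost M (\<omega> t) - b))) \<partial>traj M \<pi> s)
      + ereal (b / (1 - disc M))"
    by (rule eint_shift[OF prob]) measurable
  also have "(\<integral>\<^sup>+\<omega>. (\<Sum>t. ennreal (disc M ^ t * (cost M (\<omega> t) - b))) \<partial>traj M \<pi> s) = excess_value \<pi> b s"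
    unfolding excess_value_def
  proof (subst nn_integral_suminf, measurable, rule suminf_cong)
    fix t
    have "(\<integral>\<^sup>+\<omega>. ennreal (disc M ^ t * (cost M (\<omega> t) - b)) \<partial>traj M \<pi> s) =
        (\<integral>\<^sup>+\<omega>. ennreal (disc M ^ t) * ennreal (cost M (\<omega> t) - b) \<partial>traj M \<pi> s)"
      using disc_pos by (intro nn_integral_cong ennreal_mult') simp
    also have "\<dots> = ennreal (disc M ^ t) * (\<integral>\<^sup>+\<omega>. ennreal (cost M (\<omega> t) - b) \<partial>traj M \<pi> s)"
      by (rule nn_integral_cmult) measurable
    also have "(\<integral>\<^sup>+\<omega>. ennreal (cost M (\<omega> t) - b) \<partial>traj M \<pi> s) =
        stage_cost \<pi> (kernel_pol M \<pi>) (\<lambda>x. ennreal (cost M x - b)) t s"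
      using nn_integral_traj_component[OF \<pi> s, of "\<lambda>x. ennreal (cost M x - b)" t] by simp
    finally show "(\<integral>\<^sup>+\<omega>. ennreal (disc M ^ t * (cost M (\<omega> t) - b)) \<partial>traj M \<pi> s) =
        ennreal (disc M ^ t) * stage_cost \<pi> (kernel_pol M \<pi>) (\<lambda>x. ennreal (cost M x - b)) t s" .
  qed
  finally show ?thesis .
qed

lemma measurable_excess_value [measurable]:
  assumes "\<pi> \<in> policies M"
  shows "excess_value \<pi> b \<in> borel_measurable (state_space M)"
proof -
  note [measurable] = measurable_stage_cost[OF assms]
  show ?thesis
    unfolding excess_value_def[abs_def] by measurable
qed

text \<open>
  The first term of the series is the expected cost of the first stage; in the others one application
  of the state kernel and one discount factor can be taken out.
\<close>

lemma excess_value_step: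
  assumes \<pi>: "\<pi> \<in> policies M" and s: "s \<in> states M"
  shows "excess_value \<pi> b s = (\<integral>\<^sup>+a. ennreal (cost M (s, a) - b) \<partial>\<pi> s)
    + ennreal (disc M) * (\<integral>\<^sup>+s'. excess_value \<pi> b s' \<partial>kernel_pol M \<pi> s)"
proof -
  let ?c = "stage_cost \<pi> (kernel_pol M \<pi>) (\<lambda>x. ennreal (cost M x - b))"
  note [measurable] = measurable_stage_cost[OF \<pi>]
  note [measurable_cong] = kernel_pol_simps(2)[OF \<pi> s]
  have "(\<integral>\<^sup>+s'. excess_value \<pi> b s' \<partial>kernel_pol M \<pi> s) = (\<Sum>t. ennreal (disc M ^ t) * ?c (Suc t) s)"
    unfolding excess_value_def
    by (simp add: nn_integral_suminf nn_integral_cmult)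
  then have "ennreal (disc M) * (\<integral>\<^sup>+s'. excess_value \<pi> b s' \<partial>kernel_pol M \<pi> s) =
      (\<Sum>t. ennreal (disc M ^ Suc t) * ?c (Suc t) s)"
    using disc_pos by (simp add: ennreal_mult mult.assoc del: stage_cost.simps flip: ennreal_suminf_cmult)
  moreover have "excess_value \<pi> b s = ?c 0 s + (\<Sum>t. ennreal (disc M ^ Suc t) * ?c (Suc t) s)"
    unfolding excess_value_def by (subst suminf_offset[where i=1]) (simp_all del: stage_cost.simps)
  ultimately show ?thesis
    by simp
qed

end

section \<open>Functions bounded in the weighted norm\<close>

lemma wnorm_le_iff:
  assumes w: "\<forall>s\<in>S. 1 \<le> w s" and "0 \<le> E"
  shows "wnorm S w v \<le> ennreal E \<longleftrightarrow> (\<forall>s\<in>S. \<bar>v s\<bar> \<le> ereal (E * w s))"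
proof -
  have "e2ennreal (\<bar>x\<bar> / ereal r) \<le> ennreal E \<longleftrightarrow> \<bar>x\<bar> \<le> ereal (E * r)" if "1 \<le> r" for x r
  proof (cases x)
    case (real y)
    then show ?thesis
      using that \<open>0 \<le> E\<close> by (simp add: ennreal_le_iff pos_divide_le_eq)
  qed (use that in \<open>auto simp: top_unique\<close>)
  then show ?thesis
    using w unfolding wnorm_def by (auto simp: SUP_le_iff)
qed

lemma wnorm_finiteE:
  assumes "\<forall>s\<in>S. 1 \<le> w s" "wnorm S w v < \<infinity>"
  obtains C where "0 \<le> C" "\<And>s. s \<in> S \<Longrightarrow> \<bar>v s\<bar> \<le> ereal (C * w s)"
proof -
  obtain C where "0 \<le> C" "wnorm S w v = ennreal C"
    using assms(2) by (cases "wnorm S w v" rule: ennreal_cases) auto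
  then show thesis
    using that wnorm_le_iff[OF assms(1), of C v] by auto
qed

text \<open>
  The real-valued functions on which the contraction argument takes place. The lower bound by a
  constant is part of the notion because integrals of such functions can be averaged over actions.
\<close>

definition wbounded :: "'s::topological_space set \<Rightarrow> ('s \<Rightarrow> real) \<Rightarrow> ('s \<Rightarrow> real) \<Rightarrow> bool" where
  "wbounded S w u \<longleftrightarrow> u \<in> borel_measurable (restrict_space borel S) \<and>
     (\<exists>K\<ge>0. \<forall>s\<in>S. \<bar>u s\<bar> \<le> K * w s) \<and> (\<exists>\<beta>. \<forall>s\<in>S. \<beta> \<le> u s)"

lemma wbounded_measurable: "wbounded S w u \<Longrightarrow> u \<in> borel_measurable (restrict_space borel S)"
  by (simp add: wbounded_def)

lemma wbounded_affine:
  assumes "wbounded S w u" "\<forall>s\<in>S. 1 \<le> w s" "0 \<le> r"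
  shows "wbounded S w (\<lambda>s. r * u s + q)"
proof -
  obtain K \<beta> where K: "0 \<le> K" "\<forall>s\<in>S. \<bar>u s\<bar> \<le> K * w s" and \<beta>: "\<forall>s\<in>S. \<beta> \<le> u s"
    using assms(1) by (auto simp: wbounded_def)
  have "\<bar>r * u s + q\<bar> \<le> (r * K + \<bar>q\<bar>) * w s" if "s \<in> S" for s
  proof -
    have "\<bar>r * u s + q\<bar> \<le> r * \<bar>u s\<bar> + \<bar>q\<bar> * 1"
      using \<open>0 \<le> r\<close> abs_triangle_ineq[of "r * u s" q] by (simp add: abs_mult)
    also have "\<dots> \<le> r * (K * w s) + \<bar>q\<bar> * w s"
      using K assms that by (intro add_mono mult_left_mono) auto
    finally show ?thesis
      by (simp add: algebra_simps)
  qed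
  moreover have "r * \<beta> + q \<le> r * u s + q" if "s \<in> S" for s
    using \<beta> that \<open>0 \<le> r\<close> by (simp add: mult_left_mono)
  moreover have "(\<lambda>s. r * u s + q) \<in> borel_measurable (restrict_space borel S)"
    using wbounded_measurable[OF assms(1)] by measurable
  ultimately show ?thesis
    using K(1) \<open>0 \<le> r\<close> unfolding wbounded_def by (metis abs_ge_zero add_nonneg_nonneg mult_nonneg_nonneg)
qed

lemma wbounded_diff:
  assumes "wbounded S w u" "wbounded S w v"
  obtains K where "0 \<le> K" "\<forall>s\<in>S. \<bar>u s - v s\<bar> \<le> K * w s"
proof -
  obtain K L where K: "0 \<le> K" "\<forall>s\<in>S. \<bar>u s\<bar> \<le> K * w s" and L: "0 \<le> L" "\<forall>s\<in>S. \<bar>v s\<bar> \<le> L * w s"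
    using assms by (auto simp: wbounded_def)
  have "\<bar>u s - v s\<bar> \<le> (K + L) * w s" if "s \<in> S" for s
    using K(2)[rule_format, OF that] L(2)[rule_format, OF that] by (simp add: distrib_right)
  then show thesis
    using K L that[of "K + L"] by simp
qed

lemma wbounded_of_ereal:
  assumes w: "\<forall>s\<in>S. 1 \<le> w s"
    and "v \<in> borel_measurable (restrict_space borel S)"
    and "0 \<le> K" and K: "\<And>s. s \<in> S \<Longrightarrow> \<bar>v s\<bar> \<le> ereal (K * w s)"
    and \<beta>: "\<And>s. s \<in> S \<Longrightarrow> ereal \<beta> \<le> v s"
  shows "wbounded S w (\<lambda>s. real_of_ereal (v s))"
    and "\<And>s. s \<in> S \<Longrightarrow> v s = ereal (real_of_ereal (v s))"
proof -
  show eq: "v s = ereal (real_of_ereal (v s))" if "s \<in> S" for s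
    using K[OF that] by (cases "v s") auto
  have "\<bar>real_of_ereal (v s)\<bar> \<le> K * w s" "\<beta> \<le> real_of_ereal (v s)" if "s \<in> S" for s
    using K[OF that] \<beta>[OF that] eq[OF that] by (metis abs_ereal.simps(1) ereal_less_eq(3))+
  then show "wbounded S w (\<lambda>s. real_of_ereal (v s))"
    using assms(2,3) unfolding wbounded_def by auto
qed

section \<open>Bellman equations and averages over actions\<close>

context markov_model
begin

lemma cost_bounded_below:
  obtains b where "\<forall>x\<in>states M \<times> actions M. b \<le> cost M x"
  using is_mdp by (auto simp: is_mdp_def)

lemma cost_pol_eq:
  assumes b: "\<forall>x\<in>states M \<times> actions M. b \<le> cost M x"
    and \<pi>: "\<pi> \<in> policies M" and s: "s \<in> states M"
  shows "cost_pol M \<pi> s = enn2ereal (\<integral>\<^sup>+a. ennreal (cost M (s, a) - b) \<partial>\<pi> s) + ereal b"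
proof -
  note [measurable_cong] = policy_simps(2)[OF \<pi> s]
  note [measurable] = measurable_cost_action[OF s]
  have "cost_pol M \<pi> s = eint (\<pi> s) (\<lambda>a. enn2ereal (ennreal (cost M (s, a) - b)) + ereal b)"
    unfolding cost_pol_def using b s by (intro eint_cong) (simp add: policy_simps[OF \<pi> s])
  also have "\<dots> = enn2ereal (\<integral>\<^sup>+a. ennreal (cost M (s, a) - b) \<partial>\<pi> s) + ereal b"
    by (rule eint_shift[OF policy_simps(1)[OF \<pi> s]]) measurable
  finally show ?thesis .
qed

text \<open>
  This holds for every policy, with infinite values allowed: the shift \<open>b / (1 - \<gamma>)\<close> of the value is
  reproduced as \<open>b + \<gamma> b / (1 - \<gamma>)\<close> by one step.
\<close>

lemma val_fixpoint:
  assumes \<pi>: "\<pi> \<in> policies M" and s: "s \<in> states M"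
  shows "val M \<pi> s = cost_pol M \<pi> s + ereal (disc M) * eint (kernel_pol M \<pi> s) (val M \<pi>)"
proof -
  obtain b where b: "\<forall>x\<in>states M \<times> actions M. b \<le> cost M x"
    by (rule cost_bounded_below)
  note K = kernel_pol_simps[OF \<pi> s]
  let ?e = "excess_value \<pi> b"
  have m: "?e \<in> borel_measurable (kernel_pol M \<pi> s)"
    using measurable_excess_value[OF \<pi>, of b] K(2) by (simp cong: measurable_cong_sets)
  have "eint (kernel_pol M \<pi> s) (val M \<pi>) =
      eint (kernel_pol M \<pi> s) (\<lambda>s'. enn2ereal (?e s') + ereal (b / (1 - disc M)))"
    by (intro eint_cong) (simp add: K val_eq_excess_value[OF b \<pi>])
  also have "\<dots> = enn2ereal (\<integral>\<^sup>+s'. ?e s' \<partial>kernel_pol M \<pi> s) + ereal (b / (1 - disc M))"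
    by (rule eint_shift[OF K(1) m])
  finally have 1: "eint (kernel_pol M \<pi> s) (val M \<pi>) = \<dots>" .
  have d: "x + ereal (b / (1 - disc M)) + y = x + ereal b + (y + ereal (disc M * (b / (1 - disc M))))" for x y
  proof -
    have "b / (1 - disc M) = b + disc M * (b / (1 - disc M))"
      using disc_less_1 by (simp add: field_simps)
    then show ?thesis
      by (cases x; cases y) auto
  qed
  have "val M \<pi> s = enn2ereal (\<integral>\<^sup>+a. ennreal (cost M (s, a) - b) \<partial>\<pi> s)
      + ereal (disc M) * enn2ereal (\<integral>\<^sup>+s'. ?e s' \<partial>kernel_pol M \<pi> s) + ereal (b / (1 - disc M))"
    using disc_pos by (simp add: val_eq_excess_value[OF b \<pi> s] excess_value_step[OF \<pi> s] plus_ennreal.rep_eq times_ennreal.rep_eq)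
  also have "\<dots> = cost_pol M \<pi> s + (ereal (disc M) * enn2ereal (\<integral>\<^sup>+s'. ?e s' \<partial>kernel_pol M \<pi> s)
      + ereal (disc M * (b / (1 - disc M))))"
    unfolding cost_pol_eq[OF b \<pi> s] d[symmetric] by (simp only: ac_simps)
  also have "\<dots> = cost_pol M \<pi> s + ereal (disc M) * eint (kernel_pol M \<pi> s) (val M \<pi>)"
    unfolding 1 by (cases "\<integral>\<^sup>+s'. ?e s' \<partial>kernel_pol M \<pi> s" rule: ennreal_cases)
      (use disc_pos in \<open>auto simp: algebra_simps\<close>)
  finally show ?thesis .
qed

text \<open>
  A policy step is the average, under the policy, of the one-step costs of the single actions. It
  therefore cannot fall below their infimum, which is the content of the next lemma.
\<close>

lemma bellman_pol_eq_average:
  assumes \<pi>: "\<pi> \<in> policies M" and s: "s \<in> states M"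
    and f: "f \<in> borel_measurable (state_space M)" and \<beta>: "\<And>s. s \<in> states M \<Longrightarrow> ereal \<beta> \<le> f s"
  shows "bellman_pol M \<pi> f s =
    eint (\<pi> s) (\<lambda>a. ereal (cost M (s, a)) + ereal (disc M) * eint (kernel M (s, a)) f)"
proof -
  note P = policy_simps[OF \<pi> s] and k = measurable_kernel_action[OF s]
  note [measurable_cong] = P(2)
  note [measurable] = measurable_cost_action[OF s] borel_measurable_eint[OF k f]
  obtain b where b: "\<forall>x\<in>states M \<times> actions M. b \<le> cost M x"
    by (rule cost_bounded_below)
  have ke: "ereal \<beta> \<le> eint (kernel M (s, a)) f" if "a \<in> actions M" for a
  proof -
    have "prob_space (kernel M (s, a))" "space (kernel M (s, a)) = states M"
      using kernel_in[OF s that] by (auto simp: space_prob_algebra dest: sets_eq_imp_space_eq)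
    then show ?thesis
      using eint_mono[of "kernel M (s, a)" "\<lambda>_. ereal \<beta>" f] \<beta> by (simp add: eint_const)
  qed
  have "eint (\<pi> s) (\<lambda>a. ereal (cost M (s, a)) + ereal (disc M) * eint (kernel M (s, a)) f) =
      eint (\<pi> s) (\<lambda>a. ereal (cost M (s, a))) + eint (\<pi> s) (\<lambda>a. ereal (disc M) * eint (kernel M (s, a)) f)"
  proof (rule eint_add[OF P(1)])
    show "ereal b \<le> ereal (cost M (s, a))" if "a \<in> space (\<pi> s)" for a
      using that b s by (simp add: P)
    show "ereal (disc M * \<beta>) \<le> ereal (disc M) * eint (kernel M (s, a)) f" if "a \<in> space (\<pi> s)" for a
      using ereal_mult_left_mono[OF ke, of a "ereal (disc M)"] that disc_pos by (simp add: P)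
  qed measurable
  also have "\<dots> = cost_pol M \<pi> s + ereal (disc M) * eint (\<pi> s) (\<lambda>a. eint (kernel M (s, a)) f)"
    using disc_pos by (simp add: cost_pol_def eint_cmult)
  also have "eint (\<pi> s) (\<lambda>a. eint (kernel M (s, a)) f) = eint (kernel_pol M \<pi> s) f"
    unfolding kernel_pol_def using \<beta>
    by (intro eint_bind[symmetric, OF policy_in[OF \<pi> s] k f]) auto
  finally show ?thesis
    using s by (simp add: bellman_pol_def)
qed

lemma bellman_opt_le_pol:
  assumes \<pi>: "\<pi> \<in> policies M" and s: "s \<in> states M"
    and f: "f \<in> borel_measurable (state_space M)" and \<beta>: "\<And>s. s \<in> states M \<Longrightarrow> ereal \<beta> \<le> f s"
  shows "bellman_opt M f s \<le> bellman_pol M \<pi> f s"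
proof -
  note P = policy_simps[OF \<pi> s]
  have "bellman_opt M f s = eint (\<pi> s) (\<lambda>_. bellman_opt M f s)"
    using P(1) by (simp add: eint_const)
  also have "\<dots> \<le> bellman_pol M \<pi> f s"
    by (subst bellman_pol_eq_average[OF assms], assumption, rule eint_mono) (auto simp: bellman_opt_def s P intro!: INF_lower)
  finally show ?thesis .
qed

end

section \<open>Contraction for stable policies\<close>

text \<open>
  The Bellman operator of a policy acting on real-valued functions. For stable policies and weighted
  bounded functions it agrees with \<^const>\<open>bellman_pol\<close> (see \<open>bellman_pol_real\<close>).
\<close>

definition pol_step ::
  "('s::polish_space, 'a::polish_space) mdp \<Rightarrow> ('s \<Rightarrow> 'a measure) \<Rightarrow> ('s \<Rightarrow> real) \<Rightarrow> 's \<Rightarrow> real" where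
  "pol_step M \<pi> u s = real_of_ereal (cost_pol M \<pi> s) + disc M * (\<integral>s'. u s' \<partial>kernel_pol M \<pi> s)"

locale weighted_model = markov_model M for M :: "('s::polish_space, 'a::polish_space) mdp" +
  fixes w :: "'s \<Rightarrow> real" and \<kappa> :: real
  assumes w_ge_1: "\<forall>s\<in>states M. 1 \<le> w s" and \<kappa>_pos: "0 < \<kappa>" and contracting: "disc M * \<kappa> < 1"
begin

lemma w_pos: "s \<in> states M \<Longrightarrow> 0 < w s"
  using w_ge_1 by fastforce

context
  fixes \<pi> assumes \<pi>: "\<pi> \<in> stable_policies \<kappa> w M"
begin

lemma stable_policy: "\<pi> \<in> policies M"
  using \<pi> by (simp add: stable_policies_def)

lemma stable_drift:
  "s \<in> states M \<Longrightarrow> (\<integral>\<^sup>+s'. ennreal (w s') \<partial>kernel_pol M \<pi> s) \<le> ennreal (\<kappa> * w s)"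
  using \<pi> by (simp add: stable_policies_def)

lemma stable_cost_bound:
  obtains C where "0 \<le> C" "\<And>s. s \<in> states M \<Longrightarrow> \<bar>cost_pol M \<pi> s\<bar> \<le> ereal (C * w s)"
  using \<pi> wnorm_finiteE[OF w_ge_1] unfolding stable_policies_def by blast

lemma stable_cost_real:
  assumes "s \<in> states M"
  shows "cost_pol M \<pi> s = ereal (real_of_ereal (cost_pol M \<pi> s))"
proof -
  obtain C where "\<And>s. s \<in> states M \<Longrightarrow> \<bar>cost_pol M \<pi> s\<bar> \<le> ereal (C * w s)"
    using stable_cost_bound by blast
  from this[OF assms] show ?thesis
    by (cases "cost_pol M \<pi> s") auto
qed

text \<open>
  The stability condition enters the contraction only here: integrating against the state kernel
  multiplies a weighted bound by at most \<open>\<kappa>\<close>.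
\<close>

lemma stable_integral:
  assumes "u \<in> borel_measurable (state_space M)" and "0 \<le> K"
    and K: "\<And>s. s \<in> states M \<Longrightarrow> \<bar>u s\<bar> \<le> K * w s" and s: "s \<in> states M"
  shows "integrable (kernel_pol M \<pi> s) u" "\<bar>\<integral>s'. u s' \<partial>kernel_pol M \<pi> s\<bar> \<le> \<kappa> * K * w s"
proof -
  note P = kernel_pol_simps[OF stable_policy s]
  note [measurable_cong] = P(2)
  note [measurable] = assms(1)
  have "(\<integral>\<^sup>+s'. ennreal \<bar>u s'\<bar> \<partial>kernel_pol M \<pi> s) \<le> ennreal (K * (\<kappa> * w s))"
    using assms P \<kappa>_pos w_pos[OF s]
    by (intro nn_integral_le_weight[OF _ _ _ _ stable_drift]) (auto intro!: ennreal_leI)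
  then have n: "(\<integral>\<^sup>+s'. ennreal (norm (u s')) \<partial>kernel_pol M \<pi> s) \<le> ennreal (\<kappa> * K * w s)"
    by (simp add: ac_simps)
  show i: "integrable (kernel_pol M \<pi> s) u"
    by (rule integrableI_bounded) (use n in \<open>auto intro: order_le_less_trans\<close>)
  have "ennreal (norm (\<integral>s'. u s' \<partial>kernel_pol M \<pi> s)) \<le> ennreal (\<kappa> * K * w s)"
    using integral_norm_bound_ennreal[OF i] n by (rule order_trans)
  then show "\<bar>\<integral>s'. u s' \<partial>kernel_pol M \<pi> s\<bar> \<le> \<kappa> * K * w s"
    using \<kappa>_pos w_pos[OF s] \<open>0 \<le> K\<close> by (subst (asm) ennreal_le_iff) auto
qed

lemma stable_integrable:
  "wbounded (states M) w u \<Longrightarrow> s \<in> states M \<Longrightarrow> integrable (kernel_pol M \<pi> s) u"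
  unfolding wbounded_def using stable_integral(1) by blast

lemma eint_kernel_pol_real:
  assumes u: "wbounded (states M) w u" and s: "s \<in> states M"
    and v: "\<And>s. s \<in> states M \<Longrightarrow> v s = ereal (u s)"
  shows "eint (kernel_pol M \<pi> s) v = ereal (\<integral>s'. u s' \<partial>kernel_pol M \<pi> s)"
proof -
  have "eint (kernel_pol M \<pi> s) v = eint (kernel_pol M \<pi> s) (\<lambda>s'. ereal (u s'))"
    using v by (intro eint_cong) (simp add: kernel_pol_simps[OF stable_policy s])
  then show ?thesis
    by (simp add: eint_real[OF stable_integrable[OF u s]])
qed

lemma bellman_pol_real:
  assumes u: "wbounded (states M) w u" and s: "s \<in> states M"
    and v: "\<And>s. s \<in> states M \<Longrightarrow> v s = ereal (u s)"
  shows "bellman_pol M \<pi> v s = ereal (pol_step M \<pi> u s)"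
  using s stable_cost_real[OF s]
  by (simp add: bellman_pol_def eint_kernel_pol_real[OF assms] pol_step_def flip: plus_ereal.simps(1))

lemma pol_step_contraction:
  assumes u: "wbounded (states M) w u" and v: "wbounded (states M) w v"
    and K: "0 \<le> K" "\<forall>s\<in>states M. \<bar>u s - v s\<bar> \<le> K * w s" and s: "s \<in> states M"
  shows "\<bar>pol_step M \<pi> u s - pol_step M \<pi> v s\<bar> \<le> disc M * \<kappa> * K * w s"
proof -
  have "(\<lambda>s. u s - v s) \<in> borel_measurable (state_space M)"
    using wbounded_measurable[OF u] wbounded_measurable[OF v] by measurable
  from stable_integral(2)[OF this K(1) _ s] K(2)
  have "\<bar>\<integral>s'. u s' - v s' \<partial>kernel_pol M \<pi> s\<bar> \<le> \<kappa> * K * w s"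
    by blast
  moreover have "pol_step M \<pi> u s - pol_step M \<pi> v s = disc M * (\<integral>s'. u s' - v s' \<partial>kernel_pol M \<pi> s)"
    using stable_integrable[OF u s] stable_integrable[OF v s]
    by (simp add: pol_step_def algebra_simps)
  ultimately show ?thesis
    using disc_pos by (simp add: abs_mult mult.assoc)
qed

text \<open>
  The expected cost of stage \<open>t\<close> grows at most like \<open>\<kappa>\<^sup>t\<close>, and the series of \<open>(\<gamma>\<kappa>)\<^sup>t\<close> converges.
\<close>

lemma excess_value_bound:
  assumes b: "\<forall>x\<in>states M \<times> actions M. b \<le> cost M x"
  obtains C where "0 \<le> C" "\<And>s. s \<in> states M \<Longrightarrow> excess_value \<pi> b s \<le> ennreal (C * w s)"
proof -
  let ?c = "stage_cost \<pi> (kernel_pol M \<pi>) (\<lambda>x. ennreal (cost M x - b))"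
  obtain C0 where C0: "0 \<le> C0" "\<And>s. s \<in> states M \<Longrightarrow> \<bar>cost_pol M \<pi> s\<bar> \<le> ereal (C0 * w s)"
    using stable_cost_bound by blast
  define C where "C = C0 + \<bar>b\<bar>"
  have C: "0 \<le> C" using C0 by (simp add: C_def)
  have stage: "?c t s \<le> ennreal (C * \<kappa> ^ t * w s)" if "s \<in> states M" for s t
    using that
  proof (induction t arbitrary: s)
    case (0 s)
    have "cost_pol M \<pi> s \<le> ereal (C0 * w s)"
      using C0(2)[OF 0] by (cases "cost_pol M \<pi> s") auto
    then have "enn2ereal (?c 0 s) + ereal b \<le> ereal (C0 * w s)"
      by (simp add: cost_pol_eq[OF b stable_policy 0])
    then have "?c 0 s \<le> ennreal (C0 * w s - b)"
      by (cases "?c 0 s" rule: ennreal_cases) (auto intro!: ennreal_leI simp del: stage_cost.simps)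
    also have "\<dots> \<le> ennreal (C * w s)"
    proof (rule ennreal_leI)
      have "\<bar>b\<bar> * 1 \<le> \<bar>b\<bar> * w s"
        using w_ge_1 0 by (intro mult_left_mono) auto
      then show "C0 * w s - b \<le> C * w s"
        by (simp add: C_def algebra_simps)
    qed
    finally show ?case by simp
  next
    case (Suc t s)
    note P = kernel_pol_simps[OF stable_policy Suc.prems]
    have "?c (Suc t) s \<le> ennreal (C * \<kappa> ^ t * (\<kappa> * w s))"
      unfolding stage_cost.simps
    proof (rule nn_integral_le_weight[OF _ _ _ _ stable_drift[OF Suc.prems]])
      show "?c t \<in> borel_measurable (kernel_pol M \<pi> s)"
        using measurable_stage_cost[OF stable_policy, of "\<lambda>x. ennreal (cost M x - b)" t] P(2)
        by (simp cong: measurable_cong_sets)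
    qed (use Suc P C \<kappa>_pos w_pos[OF Suc.prems] in auto)
    then show ?case
      by (simp add: ac_simps)
  qed
  have "excess_value \<pi> b s \<le> ennreal (C / (1 - disc M * \<kappa>) * w s)" if s: "s \<in> states M" for s
  proof -
    have "excess_value \<pi> b s \<le> (\<Sum>t. ennreal (C * w s * (disc M * \<kappa>) ^ t))"
      unfolding excess_value_def
    proof (intro suminf_le summableI)
      fix t
      have "ennreal (disc M ^ t) * ?c t s \<le> ennreal (disc M ^ t) * ennreal (C * \<kappa> ^ t * w s)"
        by (intro mult_left_mono stage s) simp
      also have "\<dots> = ennreal (C * w s * (disc M * \<kappa>) ^ t)"
        using disc_pos by (simp add: ac_simps power_mult_distrib flip: ennreal_mult')
      finally show "ennreal (disc M ^ t) * ?c t s \<le> ennreal (C * w s * (disc M * \<kappa>) ^ t)" .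
    qed
    also have "\<dots> = ennreal (C * w s * (1 / (1 - disc M * \<kappa>)))"
      using disc_pos \<kappa>_pos contracting C w_pos[OF s]
      by (intro suminf_ennreal_eq sums_mult geometric_sums) auto
    finally show ?thesis by simp
  qed
  moreover have "0 \<le> C / (1 - disc M * \<kappa>)"
    using C contracting by simp
  ultimately show thesis
    by (rule that[rotated])
qed

lemma val_real:
  obtains v where "wbounded (states M) w v" "\<And>s. s \<in> states M \<Longrightarrow> val M \<pi> s = ereal (v s)"
    "\<And>s. s \<in> states M \<Longrightarrow> v s = pol_step M \<pi> v s"
proof -
  obtain b where b: "\<forall>x\<in>states M \<times> actions M. b \<le> cost M x"
    by (rule cost_bounded_below)
  obtain C where C: "0 \<le> C" "\<And>s. s \<in> states M \<Longrightarrow> excess_value \<pi> b s \<le> ennreal (C * w s)"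
    using excess_value_bound[OF b] by blast
  define e where "e s = enn2real (excess_value \<pi> b s)" for s
  define v where "v s = 1 * e s + b / (1 - disc M)" for s
  have e: "excess_value \<pi> b s = ennreal (e s)" if "s \<in> states M" for s
    using C(2)[OF that] unfolding e_def
    by (metis ennreal_enn2real ennreal_less_top order_le_less_trans)
  have "e \<in> borel_measurable (state_space M)"
    unfolding e_def[abs_def] using measurable_excess_value[OF stable_policy] by measurable
  moreover have "\<bar>e s\<bar> \<le> C * w s" "0 \<le> e s" if "s \<in> states M" for s
  proof -
    show "0 \<le> e s" by (simp add: e_def)
    then show "\<bar>e s\<bar> \<le> C * w s"
      using C(2)[OF that] e[OF that] C(1) w_pos[OF that] by simp
  qed
  ultimately have "wbounded (states M) w e"
    using C(1) unfolding wbounded_def by blast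
  then have wb: "wbounded (states M) w v"
    unfolding v_def[abs_def] by (intro wbounded_affine w_ge_1) auto
  have v: "val M \<pi> s = ereal (v s)" if "s \<in> states M" for s
  proof -
    have "0 \<le> e s"
      by (simp add: e_def)
    then show ?thesis
      using val_eq_excess_value[OF b stable_policy that] e[OF that] by (simp add: v_def)
  qed
  have "v s = pol_step M \<pi> v s" if s: "s \<in> states M" for s
    using bellman_pol_real[OF wb s v] val_fixpoint[OF stable_policy s] s v[OF s]
    by (simp add: bellman_pol_def)
  with wb v show thesis
    by (rule that)
qed

end

lemma greedy_le:
  assumes \<mu>: "\<mu> \<in> greedy M v \<inter> stable_policies \<kappa> w M" and \<pi>: "\<pi> \<in> stable_policies \<kappa> w M"
    and u: "wbounded (states M) w u" and v: "v = (\<lambda>s\<in>states M. ereal (u s))" and s: "s \<in> states M"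
  shows "pol_step M \<mu> u s \<le> pol_step M \<pi> u s"
proof -
  obtain \<beta> where \<beta>: "\<And>s. s \<in> states M \<Longrightarrow> \<beta> \<le> u s"
    using u by (auto simp: wbounded_def)
  have "v \<in> borel_measurable (state_space M)"
    using wbounded_measurable[OF u] unfolding v
    by (subst measurable_cong[where g="\<lambda>s. ereal (u s)"]) auto
  then have "bellman_opt M v s \<le> bellman_pol M \<pi> v s"
    using \<beta> by (intro bellman_opt_le_pol[OF stable_policy[OF \<pi>] s, of v \<beta>]) (auto simp: v)
  moreover have "bellman_opt M v s = bellman_pol M \<mu> v s"
    using \<mu> by (simp add: greedy_def)
  ultimately show ?thesis
    using bellman_pol_real[OF \<pi> u s, of v] bellman_pol_real[OF _ u s, of \<mu> v] \<mu> by (simp add: v)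
qed

text \<open>
  DP-solvability turns the optimal value function into a real-valued weighted bounded fixed point of
  the optimal Bellman operator.
\<close>

lemma opt_val_real:
  assumes "dp_solvable cmin w M"
  obtains u where "wbounded (states M) w u" "opt_val M = (\<lambda>s\<in>states M. ereal (u s))"
    "bellman_opt M (opt_val M) = opt_val M"
proof -
  obtain V where V: "V \<in> Vw cmin w M" "is_opt_val M V" "V = bellman_opt M V"
    using assms by (auto simp: dp_solvable_def)
  then have eq: "opt_val M = V"
    using is_opt_val_unique is_opt_val_opt_val[OF assms] by blast
  have ext: "V \<in> extensional (states M)" and m: "V \<in> borel_measurable (state_space M)"
    and low: "\<And>s. s \<in> states M \<Longrightarrow> ereal (cmin / (1 - disc M)) \<le> V s"
    and fin: "wnorm (states M) w V < \<infinity>"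
    using V(1) by (auto simp: Vw_def Vfun_def)
  obtain K where K: "0 \<le> K" "\<And>s. s \<in> states M \<Longrightarrow> \<bar>V s\<bar> \<le> ereal (K * w s)"
    using wnorm_finiteE[OF w_ge_1 fin] by blast
  note r = wbounded_of_ereal[OF w_ge_1 m K low]
  have "V = (\<lambda>s\<in>states M. ereal (real_of_ereal (V s)))"
    using ext r(2) by (intro extensionalityI[where A="states M"]) auto
  with r(1) V(3) show thesis
    by (intro that) (simp_all add: eq)
qed

lemma opt_val_le_pol_step:
  assumes u: "wbounded (states M) w u" and v: "opt_val M = (\<lambda>s\<in>states M. ereal (u s))"
    and fp: "bellman_opt M (opt_val M) = opt_val M"
    and \<pi>: "\<pi> \<in> stable_policies \<kappa> w M" and s: "s \<in> states M"
  shows "u s \<le> pol_step M \<pi> u s"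
proof -
  obtain \<beta> where \<beta>: "\<And>s. s \<in> states M \<Longrightarrow> \<beta> \<le> u s"
    using u by (auto simp: wbounded_def)
  have "opt_val M \<in> borel_measurable (state_space M)"
    using wbounded_measurable[OF u] unfolding v
    by (subst measurable_cong[where g="\<lambda>s. ereal (u s)"]) auto
  then have "bellman_opt M (opt_val M) s \<le> bellman_pol M \<pi> (opt_val M) s"
    using \<beta> by (intro bellman_opt_le_pol[OF stable_policy[OF \<pi>] s, of _ \<beta>]) (auto simp: v)
  then show ?thesis
    using bellman_pol_real[OF \<pi> u s, of "opt_val M"] s by (simp add: fp) (simp add: v)
qed

lemma opt_val_eq_pol_step:
  assumes u: "wbounded (states M) w u" and v: "opt_val M = (\<lambda>s\<in>states M. ereal (u s))"
    and fp: "bellman_opt M (opt_val M) = opt_val M"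
    and \<pi>: "\<pi> \<in> greedy M (opt_val M) \<inter> stable_policies \<kappa> w M" and s: "s \<in> states M"
  shows "u s = pol_step M \<pi> u s"
proof -
  have "bellman_pol M \<pi> (opt_val M) s = opt_val M s"
    using \<pi> fp by (simp add: greedy_def)
  moreover have "bellman_pol M \<pi> (opt_val M) s = ereal (pol_step M \<pi> u s)"
    using \<pi> by (intro bellman_pol_real[OF _ u s]) (auto simp: v)
  ultimately show ?thesis
    using s by (simp add: v)
qed

end

section \<open>Affine transformations of the cost\<close>

lemma affine_mdp_simps [simp]:
  "states (affine_mdp \<alpha>1 \<alpha>2 M) = states M" "actions (affine_mdp \<alpha>1 \<alpha>2 M) = actions M"
  "kernel (affine_mdp \<alpha>1 \<alpha>2 M) = kernel M" "disc (affine_mdp \<alpha>1 \<alpha>2 M) = disc M"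
  "cost (affine_mdp \<alpha>1 \<alpha>2 M) x = \<alpha>1 * cost M x + \<alpha>2"
  by (simp_all add: affine_mdp_def)

lemma policies_affine [simp]: "policies (affine_mdp \<alpha>1 \<alpha>2 M) = policies M"
  by (simp add: policies_def)

lemma kernel_pol_affine [simp]: "kernel_pol (affine_mdp \<alpha>1 \<alpha>2 M) \<pi> = kernel_pol M \<pi>"
  by (rule ext) (simp add: kernel_pol_def)

context markov_model
begin

lemma markov_model_affine:
  assumes "0 < \<alpha>1"
  shows "markov_model (affine_mdp \<alpha>1 \<alpha>2 M)"
proof
  obtain b where b: "\<forall>x\<in>states M \<times> actions M. b \<le> cost M x"
    by (rule cost_bounded_below)
  have "\<forall>x\<in>states M \<times> actions M. \<alpha>1 * b + \<alpha>2 \<le> cost (affine_mdp \<alpha>1 \<alpha>2 M) x"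
    using b assms by simp
  moreover have "(\<lambda>x. \<alpha>1 * cost M x + \<alpha>2) \<in> borel_measurable (sa_space M)"
    by measurable
  then have "cost (affine_mdp \<alpha>1 \<alpha>2 M) \<in> borel_measurable (sa_space M)"
    by (simp add: affine_mdp_def)
  ultimately show "is_mdp (affine_mdp \<alpha>1 \<alpha>2 M)"
    using is_mdp unfolding is_mdp_def affine_mdp_simps(1-4) by blast
qed

lemma cost_pol_affine:
  assumes "0 < \<alpha>1" and \<pi>: "\<pi> \<in> policies M" and s: "s \<in> states M"
  shows "cost_pol (affine_mdp \<alpha>1 \<alpha>2 M) \<pi> s = ereal \<alpha>1 * cost_pol M \<pi> s + ereal \<alpha>2"
proof -
  note P = policy_simps[OF \<pi> s]
  have [measurable]: "(\<lambda>a. cost M (s, a)) \<in> borel_measurable (\<pi> s)"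
    using measurable_cost_action[OF s] P(2) by (simp cong: measurable_cong_sets)
  obtain b where b: "\<forall>x\<in>states M \<times> actions M. b \<le> cost M x"
    by (rule cost_bounded_below)
  have "cost_pol (affine_mdp \<alpha>1 \<alpha>2 M) \<pi> s =
      eint (\<pi> s) (\<lambda>a. ereal \<alpha>1 * ereal (cost M (s, a)) + ereal \<alpha>2)"
    by (simp add: cost_pol_def)
  also have "\<dots> = eint (\<pi> s) (\<lambda>a. ereal \<alpha>1 * ereal (cost M (s, a))) + eint (\<pi> s) (\<lambda>a. ereal \<alpha>2)"
  proof (rule eint_add[OF P(1) _ _ _ order_refl])
    show "ereal (\<alpha>1 * b) \<le> ereal \<alpha>1 * ereal (cost M (s, a))" if "a \<in> space (\<pi> s)" for a
      using that b s assms(1) by (simp add: P mult_left_mono)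
  qed measurable
  also have "\<dots> = ereal \<alpha>1 * cost_pol M \<pi> s + ereal \<alpha>2"
    using assms(1) P(1) by (simp add: eint_const cost_pol_def eint_cmult del: times_ereal.simps)
  finally show ?thesis .
qed

lemma stage_cost_cmult:
  assumes \<pi>: "\<pi> \<in> policies M" and [measurable]: "g \<in> borel_measurable (sa_space M)"
    and s: "s \<in> states M"
  shows "stage_cost \<pi> (kernel_pol M \<pi>) (\<lambda>x. r * g x) t s = r * stage_cost \<pi> (kernel_pol M \<pi>) g t s"
  using s
proof (induction t arbitrary: s)
  case (0 s)
  note [measurable_cong] = policy_simps(2)[OF \<pi> 0]
  have [measurable]: "s \<in> space (state_space M)"
    using 0 by simp
  have "(\<lambda>a. g (s, a)) \<in> borel_measurable (\<pi> s)"
    by measurable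
  then show ?case
    by (simp add: nn_integral_cmult)
next
  case (Suc t s)
  note K = kernel_pol_simps[OF \<pi> Suc.prems]
  note [measurable_cong] = K(2)
  note [measurable] = measurable_stage_cost[OF \<pi>]
  have "stage_cost \<pi> (kernel_pol M \<pi>) (\<lambda>x. r * g x) (Suc t) s =
      (\<integral>\<^sup>+s'. r * stage_cost \<pi> (kernel_pol M \<pi>) g t s' \<partial>kernel_pol M \<pi> s)"
    using K(3) Suc.IH by (auto intro!: nn_integral_cong)
  also have "\<dots> = r * stage_cost \<pi> (kernel_pol M \<pi>) g (Suc t) s"
    by (simp add: nn_integral_cmult)
  finally show ?case .
qed

text \<open>
  The excess over the lower bound \<open>\<alpha>1 b + \<alpha>2\<close> of the new cost is \<open>\<alpha>1\<close> times the excess of the old cost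
  over \<open>b\<close>. All policies are covered, so that optimality carries over, see the next lemma.
\<close>

lemma val_affine:
  assumes "0 < \<alpha>1" and \<pi>: "\<pi> \<in> policies M" and s: "s \<in> states M"
  shows "val (affine_mdp \<alpha>1 \<alpha>2 M) \<pi> s = ereal \<alpha>1 * val M \<pi> s + ereal (\<alpha>2 / (1 - disc M))"
proof -
  interpret A: markov_model "affine_mdp \<alpha>1 \<alpha>2 M"
    by (rule markov_model_affine[OF assms(1)])
  obtain b where b: "\<forall>x\<in>states M \<times> actions M. b \<le> cost M x"
    by (rule cost_bounded_below)
  have bA: "\<forall>x\<in>states (affine_mdp \<alpha>1 \<alpha>2 M) \<times> actions (affine_mdp \<alpha>1 \<alpha>2 M).
      \<alpha>1 * b + \<alpha>2 \<le> cost (affine_mdp \<alpha>1 \<alpha>2 M) x"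
    using b assms(1) by (simp add: mult_left_mono)
  have c: "ennreal (cost (affine_mdp \<alpha>1 \<alpha>2 M) x - (\<alpha>1 * b + \<alpha>2)) = ennreal \<alpha>1 * ennreal (cost M x - b)" for x
    using assms(1) by (simp add: algebra_simps flip: ennreal_mult')
  have "A.excess_value \<pi> (\<alpha>1 * b + \<alpha>2) s = ennreal \<alpha>1 * excess_value \<pi> b s"
    unfolding A.excess_value_def excess_value_def c kernel_pol_affine affine_mdp_simps(4) ennreal_suminf_cmult[symmetric]
    using stage_cost_cmult[OF \<pi> _ s, of "\<lambda>x. ennreal (cost M x - b)"] by (simp add: ac_simps)
  then have "val (affine_mdp \<alpha>1 \<alpha>2 M) \<pi> s =
      ereal \<alpha>1 * enn2ereal (excess_value \<pi> b s) + ereal ((\<alpha>1 * b + \<alpha>2) / (1 - disc M))"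
    using A.val_eq_excess_value[OF bA, of \<pi> s] \<pi> s assms(1) by (simp add: times_ennreal.rep_eq)
  also have "\<dots> = ereal \<alpha>1 * val M \<pi> s + ereal (\<alpha>2 / (1 - disc M))"
    unfolding val_eq_excess_value[OF b \<pi> s] using assms(1)
    by (cases "excess_value \<pi> b s" rule: ennreal_cases) (auto simp: add_divide_distrib algebra_simps)
  finally show ?thesis .
qed

lemma opt_val_affine:
  assumes "0 < \<alpha>1" and opt: "is_opt_val M (opt_val M)"
  shows "opt_val (affine_mdp \<alpha>1 \<alpha>2 M) =
    (\<lambda>s\<in>states M. ereal \<alpha>1 * opt_val M s + ereal (\<alpha>2 / (1 - disc M)))" (is "_ = ?V")
proof -
  have "is_opt_val (affine_mdp \<alpha>1 \<alpha>2 M) ?V"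
    unfolding is_opt_val_def
  proof (intro conjI ballI)
    fix \<pi> s assume "\<pi> \<in> policies (affine_mdp \<alpha>1 \<alpha>2 M)" "s \<in> states (affine_mdp \<alpha>1 \<alpha>2 M)"
    then have "\<pi> \<in> policies M" "s \<in> states M"
      by simp_all
    then show "?V s \<le> val (affine_mdp \<alpha>1 \<alpha>2 M) \<pi> s"
      using opt assms(1) by (auto simp: val_affine is_opt_val_def intro!: add_right_mono ereal_mult_left_mono)
  next
    obtain \<pi> where "\<pi> \<in> policies M" "\<forall>s\<in>states M. opt_val M s = val M \<pi> s"
      using opt by (auto simp: is_opt_val_def)
    then show "\<exists>\<pi>\<in>policies (affine_mdp \<alpha>1 \<alpha>2 M). \<forall>s\<in>states (affine_mdp \<alpha>1 \<alpha>2 M).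
        ?V s = val (affine_mdp \<alpha>1 \<alpha>2 M) \<pi> s"
      using assms(1) by (intro bexI[of _ \<pi>]) (auto simp: val_affine)
  qed simp
  then show ?thesis
    unfolding opt_val_def using is_opt_val_unique by blast
qed

end

section \<open>Perturbation of fixed points\<close>

text \<open>
  The abstract contraction argument: if every bound \<open>K\<close> for \<open>d\<close> improves to \<open>q K + E\<close>, then iteration
  brings the bound down to \<open>q\<^sup>n K + E / (1 - q)\<close>. Some bound must be known beforehand.
\<close>

lemma contraction_gap:
  fixes d w :: "'s \<Rightarrow> real"
  assumes q: "0 \<le> q" "q < 1" and "0 \<le> E" and w: "\<forall>s\<in>S. 0 < w s"
    and K: "0 \<le> K" "\<forall>s\<in>S. \<bar>d s\<bar> \<le> K * w s"
    and step: "\<And>K s. 0 \<le> K \<Longrightarrow> \<forall>s\<in>S. \<bar>d s\<bar> \<le> K * w s \<Longrightarrow> s \<in> S \<Longrightarrow> \<bar>d s\<bar> \<le> (q * K + E) * w s"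
    and s: "s \<in> S"
  shows "\<bar>d s\<bar> \<le> E / (1 - q) * w s"
proof -
  have e: "q * (E / (1 - q)) + E = E / (1 - q)"
    using q by (simp add: field_simps)
  have "\<forall>s\<in>S. \<bar>d s\<bar> \<le> (q ^ n * K + E / (1 - q)) * w s" for n
  proof (induction n)
    case 0
    have "K * w s \<le> (K + E / (1 - q)) * w s" if "s \<in> S" for s
      using q \<open>0 \<le> E\<close> w that by (intro mult_right_mono) (auto intro: less_imp_le)
    with K(2) show ?case
      by fastforce
  next
    case (Suc n)
    have "q * (q ^ n * K + E / (1 - q)) + E = q ^ Suc n * K + E / (1 - q)"
      using e by (simp add: distrib_left mult.assoc)
    then show ?case
      using step[OF _ Suc] q K(1) \<open>0 \<le> E\<close> by simp
  qed
  then have *: "\<bar>d s\<bar> \<le> (q ^ n * K + E / (1 - q)) * w s" for n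
    using s by blast
  have "(\<lambda>n. (q ^ n * K + E / (1 - q)) * w s) \<longlonglongrightarrow> (0 * K + E / (1 - q)) * w s"
    using q by (intro tendsto_intros LIMSEQ_realpow_zero) auto
  then have "\<bar>d s\<bar> \<le> (0 * K + E / (1 - q)) * w s"
    by (rule LIMSEQ_le_const) (use * in auto)
  then show ?thesis
    by simp
qed

context weighted_model
begin

lemma contraction_factor_nonneg: "0 \<le> disc M * \<kappa>"
  using disc_pos \<kappa>_pos by simp

text \<open>
  Here \<open>\<pi>\<close> is a policy with fixed point \<open>y\<close>, and \<open>\<mu>\<close> is at most as costly as \<open>\<pi>\<close> at \<open>z\<close>. Upwards,
  \<open>y - z\<close> is at most \<open>\<mu> y - \<mu> z\<close> plus the residual of \<open>z\<close>; downwards, \<open>z - y\<close> is at most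
  \<open>\<pi> z - \<pi> y\<close> plus that residual, where \<open>\<pi>\<close> and \<open>\<mu>\<close> stand for their operators. For \<open>\<mu> = \<pi>\<close> the
  order hypotheses are trivial, and the lemma compares a fixed point with an approximate fixed point.
\<close>

lemma perturbation:
  assumes \<pi>: "\<pi> \<in> stable_policies \<kappa> w M" and \<mu>: "\<mu> \<in> stable_policies \<kappa> w M"
    and y: "wbounded (states M) w y" and z: "wbounded (states M) w z"
    and y_fix: "\<And>s. s \<in> states M \<Longrightarrow> y s = pol_step M \<pi> y s"
    and y_le: "\<And>s. s \<in> states M \<Longrightarrow> y s \<le> pol_step M \<mu> y s"
    and \<mu>_le: "\<And>s. s \<in> states M \<Longrightarrow> pol_step M \<mu> z s \<le> pol_step M \<pi> z s"
    and E: "0 \<le> E" "\<And>s. s \<in> states M \<Longrightarrow> \<bar>pol_step M \<mu> z s - z s\<bar> \<le> E * w s"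
    and s: "s \<in> states M"
  shows "\<bar>y s - z s\<bar> \<le> E / (1 - disc M * \<kappa>) * w s"
proof -
  obtain K where K: "0 \<le> K" "\<forall>s\<in>states M. \<bar>y s - z s\<bar> \<le> K * w s"
    using wbounded_diff[OF y z] by blast
  show ?thesis
  proof (rule contraction_gap[OF contraction_factor_nonneg contracting E(1) _ K _ s])
    show "\<forall>s\<in>states M. 0 < w s"
      using w_pos by blast
    fix K s
    assume K: "0 \<le> K" "\<forall>s\<in>states M. \<bar>y s - z s\<bar> \<le> K * w s" and s: "s \<in> states M"
    have "\<bar>pol_step M \<mu> y s - pol_step M \<mu> z s\<bar> \<le> disc M * \<kappa> * K * w s"
      "\<bar>pol_step M \<pi> y s - pol_step M \<pi> z s\<bar> \<le> disc M * \<kappa> * K * w s"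
      by (rule pol_step_contraction[OF _ y z K s]; fact)+
    then show "\<bar>y s - z s\<bar> \<le> (disc M * \<kappa> * K + E) * w s"
      using y_fix[OF s] y_le[OF s] \<mu>_le[OF s] E(2)[OF s] unfolding distrib_right by linarith
  qed
qed

lemma stable_affine:
  assumes "0 < \<alpha>1" and \<pi>: "\<pi> \<in> stable_policies \<kappa> w M"
  shows "\<pi> \<in> stable_policies \<kappa> w (affine_mdp \<alpha>1 \<alpha>2 M)"
proof -
  obtain C where C: "0 \<le> C" "\<And>s. s \<in> states M \<Longrightarrow> \<bar>cost_pol M \<pi> s\<bar> \<le> ereal (C * w s)"
    using stable_cost_bound[OF \<pi>] by blast
  have "\<bar>cost_pol (affine_mdp \<alpha>1 \<alpha>2 M) \<pi> s\<bar> \<le> ereal ((\<alpha>1 * C + \<bar>\<alpha>2\<bar>) * w s)" if s: "s \<in> states M" for s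
  proof -
    obtain c where c: "cost_pol M \<pi> s = ereal c" "\<bar>c\<bar> \<le> C * w s"
      using C(2)[OF s] stable_cost_real[OF \<pi> s] by (metis abs_ereal.simps(1) ereal_less_eq(3))
    have "\<bar>\<alpha>1 * c + \<alpha>2\<bar> \<le> \<alpha>1 * \<bar>c\<bar> + \<bar>\<alpha>2\<bar> * 1"
      using assms(1) abs_triangle_ineq[of "\<alpha>1 * c" \<alpha>2] by (simp add: abs_mult)
    also have "\<dots> \<le> \<alpha>1 * (C * w s) + \<bar>\<alpha>2\<bar> * w s"
      using c assms(1) w_ge_1 s by (intro add_mono mult_left_mono) auto
    finally show ?thesis
      by (simp add: cost_pol_affine[OF assms(1) stable_policy[OF \<pi>] s] c(1) algebra_simps)
  qed
  then have "wnorm (states M) w (cost_pol (affine_mdp \<alpha>1 \<alpha>2 M) \<pi>) \<le> ennreal (\<alpha>1 * C + \<bar>\<alpha>2\<bar>)"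
    using assms(1) C(1) by (subst wnorm_le_iff[OF w_ge_1]) auto
  then have "wnorm (states M) w (cost_pol (affine_mdp \<alpha>1 \<alpha>2 M) \<pi>) < \<infinity>"
    by (rule order_le_less_trans) simp
  then show ?thesis
    using \<pi> by (simp add: stable_policies_def)
qed

lemma pol_step_affine:
  assumes "0 < \<alpha>1" and \<pi>: "\<pi> \<in> stable_policies \<kappa> w M"
    and u: "wbounded (states M) w u" and s: "s \<in> states M"
  shows "pol_step (affine_mdp \<alpha>1 \<alpha>2 M) \<pi> (\<lambda>s. \<alpha>1 * u s + \<alpha>2 / (1 - disc M)) s =
    \<alpha>1 * pol_step M \<pi> u s + \<alpha>2 / (1 - disc M)"
proof -
  interpret P: prob_space "kernel_pol M \<pi> s"
    by (rule kernel_pol_simps(1)[OF stable_policy[OF \<pi>] s])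
  obtain c where c: "cost_pol M \<pi> s = ereal c"
    using stable_cost_real[OF \<pi> s] by blast
  have "(\<integral>s'. \<alpha>1 * u s' + \<alpha>2 / (1 - disc M) \<partial>kernel_pol M \<pi> s) =
      \<alpha>1 * (\<integral>s'. u s' \<partial>kernel_pol M \<pi> s) + \<alpha>2 / (1 - disc M)"
    using stable_integrable[OF \<pi> u s] by (simp add: P.prob_space)
  moreover have "\<alpha>2 + disc M * (\<alpha>2 / (1 - disc M)) = \<alpha>2 / (1 - disc M)"
    using disc_less_1 by (simp add: field_simps)
  ultimately show ?thesis
    by (simp add: pol_step_def cost_pol_affine[OF assms(1) stable_policy[OF \<pi>] s] c distrib_left
      mult.left_commute flip: times_divide_eq_right)
qed

section \<open>Open-loop policies\<close>

lemma open_loop_cost: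
  assumes "s \<in> states M" "a \<in> actions M"
  shows "cost_pol M (open_loop M a) s = ereal (cost M (s, a))"
  unfolding cost_pol_def open_loop_def using assms measurable_cost_action[OF assms(1)]
  by (subst eint_return) auto

lemma open_loop_kernel:
  assumes "s \<in> states M" "a \<in> actions M"
  shows "kernel_pol M (open_loop M a) s = kernel M (s, a)"
  unfolding kernel_pol_def open_loop_def
  using assms measurable_prob_algebraD[OF measurable_kernel_action[OF assms(1)]]
  by (subst bind_return[where N="state_space M"]) auto

text \<open>
  A version of \<open>bellman_pol_eq_average\<close> in which the one-step cost of an action is the step of the
  corresponding open-loop policy. The constant \<open>R\<close> is carried along so that estimates with an error
  term can be averaged directly.
\<close>

lemma pol_step_eq_average:
  assumes ol: "\<forall>a\<in>actions M. open_loop M a \<in> stable_policies \<kappa> w M"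
    and \<pi>: "\<pi> \<in> stable_policies \<kappa> w M"
    and u: "wbounded (states M) w u" and s: "s \<in> states M"
  shows "ereal (pol_step M \<pi> u s + R) = eint (\<pi> s) (\<lambda>a. ereal (pol_step M (open_loop M a) u s + R))"
proof -
  note P = policy_simps[OF stable_policy[OF \<pi>] s] and k = measurable_kernel_action[OF s]
  obtain \<beta> where \<beta>: "\<And>s. s \<in> states M \<Longrightarrow> \<beta> \<le> u s"
    using u by (auto simp: wbounded_def)
  obtain b where b: "\<forall>x\<in>states M \<times> actions M. b \<le> cost M x"
    by (rule cost_bounded_below)
  have f: "(\<lambda>s. ereal (u s)) \<in> borel_measurable (state_space M)"
    using wbounded_measurable[OF u] by measurable
  note [measurable_cong] = P(2)
  note [measurable] = measurable_cost_action[OF s] borel_measurable_eint[OF k f]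
  let ?h = "\<lambda>a. ereal (cost M (s, a)) + ereal (disc M) * eint (kernel M (s, a)) (\<lambda>s. ereal (u s))"
  have h: "?h a = ereal (pol_step M (open_loop M a) u s)" if a: "a \<in> actions M" for a
    using bellman_pol_real[OF ol[rule_format, OF a] u s, of "\<lambda>s. ereal (u s)"] s a
    by (simp add: bellman_pol_def open_loop_cost open_loop_kernel)
  have low: "ereal (b + disc M * \<beta>) \<le> ?h a" if a: "a \<in> space (\<pi> s)" for a
  proof -
    have a': "a \<in> actions M" using a by (simp add: P)
    have pr: "prob_space (kernel M (s, a))" "space (kernel M (s, a)) = states M"
      using kernel_in[OF s a'] by (auto simp: space_prob_algebra dest: sets_eq_imp_space_eq)
    have "ereal \<beta> \<le> eint (kernel M (s, a)) (\<lambda>s. ereal (u s))"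
      using eint_mono[of "kernel M (s, a)" "\<lambda>_. ereal \<beta>" "\<lambda>s. ereal (u s)"] \<beta> pr by (simp add: eint_const)
    then have "ereal (disc M) * ereal \<beta> \<le> ereal (disc M) * eint (kernel M (s, a)) (\<lambda>s. ereal (u s))"
      using disc_pos by (intro ereal_mult_left_mono) auto
    then show ?thesis
      using b s a' by (auto intro!: add_mono simp flip: plus_ereal.simps(1))
  qed
  have "eint (\<pi> s) (\<lambda>a. ereal (pol_step M (open_loop M a) u s + R)) = eint (\<pi> s) (\<lambda>a. ?h a + ereal R)"
    using h by (intro eint_cong) (simp add: P)
  also have "\<dots> = eint (\<pi> s) ?h + eint (\<pi> s) (\<lambda>a. ereal R)"
    by (rule eint_add[OF P(1) _ _ low order_refl]) measurable
  also have "eint (\<pi> s) ?h = ereal (pol_step M \<pi> u s)"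
    using bellman_pol_eq_average[OF stable_policy[OF \<pi>] s f, of \<beta>] \<beta>
      bellman_pol_real[OF \<pi> u s, of "\<lambda>s. ereal (u s)"] by simp
  finally show ?thesis
    using P(1) by (simp add: eint_const)
qed

end

section \<open>The gap between two models\<close>

locale model_pair =
  M: weighted_model M w \<kappa> + N: weighted_model N w \<kappa>
  for M N :: "('s::polish_space, 'a::polish_space) mdp" and w :: "'s \<Rightarrow> real" and \<kappa> :: real +
  fixes \<alpha>1 \<alpha>2 :: real
  assumes states_N [simp]: "states N = states M" and actions_N [simp]: "actions N = actions M"
    and disc_N [simp]: "disc N = disc M" and \<alpha>1_pos: "0 < \<alpha>1"
begin

abbreviation A :: "('s, 'a) mdp" where
  "A \<equiv> affine_mdp \<alpha>1 \<alpha>2 M"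

sublocale A: weighted_model A w \<kappa>
proof -
  interpret A: markov_model A
    by (rule M.markov_model_affine[OF \<alpha>1_pos])
  show "weighted_model A w \<kappa>"
    by unfold_locales (use M.w_ge_1 M.\<kappa>_pos M.contracting in auto)
qed

lemma open_loop_N [simp]: "open_loop N a = open_loop M a" "open_loop A a = open_loop M a"
  by (simp_all add: open_loop_def)

text \<open>
  The gap splits into a cost term, controlled by \<^const>\<open>eps\<close>, and a transition term, controlled by the
  Minkowski functional times \<^const>\<open>delta\<close>. The function is allowed to be an affine image of \<open>f\<close>: the
  shift \<open>q\<close> cancels since both state kernels have mass one, and the factor \<open>r\<close> comes out. This yields
  the factor \<open>\<alpha>1\<close> in front of \<open>\<gamma>\<close> when the optimal value of \<open>A\<close> is expressed by that of \<open>M\<close>.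
\<close>

lemma model_gap:
  assumes \<pi>: "\<pi> \<in> stable_policies \<kappa> w M" and \<pi>': "\<pi>' \<in> stable_policies \<kappa> w N"
    and f: "wbounded (states M) w f" and v: "v = (\<lambda>s\<in>states M. ereal (f s))" and r: "0 < r"
    and E: "0 \<le> E"
      "eps \<alpha>1 \<alpha>2 w M N \<pi> \<pi>' + ennreal (r * disc M) * (minkowski (states M) F v \<odot> delta F w M N \<pi> \<pi>') \<le> ennreal E"
    and s: "s \<in> states M"
  shows "\<bar>pol_step A \<pi> (\<lambda>s. r * f s + q) s - pol_step N \<pi>' (\<lambda>s. r * f s + q) s\<bar> \<le> E * w s"
proof -
  let ?P = "kernel_pol M \<pi> s" and ?Q = "kernel_pol N \<pi>' s"
  have s': "s \<in> states N" using s by simp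
  have f': "wbounded (states N) w f" using f by simp
  note P = M.kernel_pol_simps[OF M.stable_policy[OF \<pi>] s]
    and Q = N.kernel_pol_simps[OF N.stable_policy[OF \<pi>'] s']
  define m where "m = minkowski (states M) F v \<odot> delta F w M N \<pi> \<pi>'"
  have fin: "eps \<alpha>1 \<alpha>2 w M N \<pi> \<pi>' \<noteq> \<infinity>" "ennreal (r * disc M) * m \<noteq> \<infinity>"
    using E(2) unfolding m_def by (auto simp: top_unique)
  then have "m \<noteq> \<infinity>"
    using r M.disc_pos by (auto simp: ennreal_mult_eq_top_iff)
  then obtain d where d: "0 \<le> d" "m = ennreal d"
    by (cases m rule: ennreal_cases) auto
  obtain e where e: "0 \<le> e" "eps \<alpha>1 \<alpha>2 w M N \<pi> \<pi>' = ennreal e"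
    using fin(1) by (cases "eps \<alpha>1 \<alpha>2 w M N \<pi> \<pi>'" rule: ennreal_cases) auto
  have eE: "e + r * disc M * d \<le> E"
    using E d e r M.disc_pos unfolding m_def[symmetric]
    by (simp flip: ennreal_mult ennreal_plus)
  obtain c where c: "cost_pol M \<pi> s = ereal c"
    using M.stable_cost_real[OF \<pi> s] by blast
  obtain c' where c': "cost_pol N \<pi>' s = ereal c'"
    using N.stable_cost_real[OF \<pi>' s'] by blast
  have cost: "\<bar>\<alpha>1 * c + \<alpha>2 - c'\<bar> \<le> e * w s"
  proof -
    have "wnorm (states M) w (\<lambda>s. ereal \<alpha>1 * cost_pol M \<pi> s + ereal \<alpha>2 - cost_pol N \<pi>' s) \<le> ennreal e"
      using e(2) by (simp add: eps_def)
    then show ?thesis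
      using s unfolding wnorm_le_iff[OF M.w_ge_1 e(1)] by (auto dest!: bspec[of _ _ s] simp: c c')
  qed
  have int: "\<bar>(\<integral>s'. f s' \<partial>?P) - (\<integral>s'. f s' \<partial>?Q)\<bar> \<le> d * w s"
  proof -
    have m: "v \<in> borel_measurable (state_space M)"
      using wbounded_measurable[OF f] unfolding v
      by (subst measurable_cong[where g="\<lambda>s. ereal (f s)"]) auto
    have "ipm F ?P ?Q / ennreal (w s) \<le> delta F w M N \<pi> \<pi>'"
      unfolding delta_def by (rule SUP_upper[OF s])
    then have "ipm F ?P ?Q / ennreal (w s) * ennreal (w s) \<le> delta F w M N \<pi> \<pi>' * ennreal (w s)"
      by (rule mult_right_mono) simp
    then have ipm: "ipm F ?P ?Q \<le> delta F w M N \<pi> \<pi>' * ennreal (w s)"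
      using M.w_pos[OF s] by (simp add: ennreal_divide_times ennreal_divide_self)
    have md: "minkowski (states M) F v \<noteq> \<infinity>" "delta F w M N \<pi> \<pi>' \<noteq> \<infinity>"
      "minkowski (states M) F v * delta F w M N \<pi> \<pi>' = ennreal d"
      using d(2) by (auto simp: m_def ext_mult_def split: if_splits)
    have ipm_fin: "ipm F ?P ?Q \<noteq> \<infinity>"
      using ipm md(2) by (auto simp: top_unique ennreal_mult_eq_top_iff)
    have "e2ennreal \<bar>eint ?P v - eint ?Q v\<bar> \<le> minkowski (states M) F v \<odot> ipm F ?P ?Q"
      using m P Q by (intro eint_diff_le) (auto cong: measurable_cong_sets)
    also have "\<dots> = minkowski (states M) F v * ipm F ?P ?Q"
      using md(1) ipm_fin by (simp add: ext_mult_def)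
    also have "\<dots> \<le> minkowski (states M) F v * (delta F w M N \<pi> \<pi>' * ennreal (w s))"
      by (intro mult_left_mono ipm) simp
    also have "\<dots> = ennreal (d * w s)"
      using md(3) d(1) by (simp add: ennreal_mult' flip: mult.assoc)
    finally have "e2ennreal \<bar>eint ?P v - eint ?Q v\<bar> \<le> ennreal (d * w s)" .
    moreover have "eint ?P v = ereal (\<integral>s'. f s' \<partial>?P)" "eint ?Q v = ereal (\<integral>s'. f s' \<partial>?Q)"
      by (rule M.eint_kernel_pol_real[OF \<pi> f s] N.eint_kernel_pol_real[OF \<pi>' f' s']; simp add: v)+
    ultimately show ?thesis
      using d(1) M.w_pos[OF s] by (simp add: ennreal_le_iff)
  qed
  interpret P: prob_space ?P by (rule P(1))
  interpret Q: prob_space ?Q by (rule Q(1))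
  have "(\<integral>s'. r * f s' + q \<partial>?P) = r * (\<integral>s'. f s' \<partial>?P) + q" "(\<integral>s'. r * f s' + q \<partial>?Q) = r * (\<integral>s'. f s' \<partial>?Q) + q"
    using M.stable_integrable[OF \<pi> f s] N.stable_integrable[OF \<pi>' f' s'] by (simp_all add: P.prob_space Q.prob_space)
  then have "pol_step A \<pi> (\<lambda>s. r * f s + q) s - pol_step N \<pi>' (\<lambda>s. r * f s + q) s =
      (\<alpha>1 * c + \<alpha>2 - c') + r * disc M * ((\<integral>s'. f s' \<partial>?P) - (\<integral>s'. f s' \<partial>?Q))"
    by (simp add: pol_step_def M.cost_pol_affine[OF \<alpha>1_pos M.stable_policy[OF \<pi>] s] c c' algebra_simps)
  also have "\<bar>\<dots>\<bar> \<le> e * w s + r * disc M * (d * w s)"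
    using r M.disc_pos by (intro order_trans[OF abs_triangle_ineq] add_mono cost) (simp add: abs_mult int)
  also have "\<dots> = (e + r * disc M * d) * w s"
    by (simp add: algebra_simps)
  also have "\<dots> \<le> E * w s"
    using eE M.w_pos[OF s] by (intro mult_right_mono) auto
  finally show ?thesis .
qed

end

context model_pair
begin

text \<open>
  Estimates for single actions pass to stable policies by \<open>pol_step_eq_average\<close>, within either of the two
  models and from one model to the other under a common policy.
\<close>

lemma
  assumes ol: "\<forall>a\<in>actions M. open_loop M a \<in> stable_policies \<kappa> w M \<inter> stable_policies \<kappa> w N"
  shows average_A_N: "\<lbrakk>\<pi> \<in> stable_policies \<kappa> w M; \<pi> \<in> stable_policies \<kappa> w N; wbounded (states M) w f;
      s \<in> states M; \<And>a. a \<in> actions M \<Longrightarrow>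
        \<bar>pol_step A (open_loop M a) f s - pol_step N (open_loop M a) f s\<bar> \<le> R\<rbrakk>
    \<Longrightarrow> \<bar>pol_step A \<pi> f s - pol_step N \<pi> f s\<bar> \<le> R"
    and average_A: "\<lbrakk>\<pi> \<in> stable_policies \<kappa> w M; wbounded (states M) w f; s \<in> states M;
      \<And>a. a \<in> actions M \<Longrightarrow> L \<le> pol_step A (open_loop M a) f s\<rbrakk> \<Longrightarrow> L \<le> pol_step A \<pi> f s"
    and average_N: "\<lbrakk>\<pi> \<in> stable_policies \<kappa> w N; wbounded (states M) w f; s \<in> states M;
      \<And>a. a \<in> actions M \<Longrightarrow> L \<le> pol_step N (open_loop M a) f s\<rbrakk> \<Longrightarrow> L \<le> pol_step N \<pi> f s"
proof -
  have olA: "\<forall>a\<in>actions A. open_loop A a \<in> stable_policies \<kappa> w A"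
    using ol M.stable_affine[OF \<alpha>1_pos] by simp
  have olN: "\<forall>a\<in>actions N. open_loop N a \<in> stable_policies \<kappa> w N"
    using ol by simp
  have avg_A: "ereal (pol_step A \<pi> f s + R) = eint (\<pi> s) (\<lambda>a. ereal (pol_step A (open_loop M a) f s + R))"
    if "\<pi> \<in> stable_policies \<kappa> w M" "wbounded (states M) w f" "s \<in> states M" for \<pi> f s R
    using A.pol_step_eq_average[OF olA M.stable_affine[OF \<alpha>1_pos that(1)], of f s R] that by simp
  have avg_N: "ereal (pol_step N \<pi> f s + R) = eint (\<pi> s) (\<lambda>a. ereal (pol_step N (open_loop M a) f s + R))"
    if "\<pi> \<in> stable_policies \<kappa> w N" "wbounded (states M) w f" "s \<in> states M" for \<pi> f s R
    using N.pol_step_eq_average[OF olN that(1), of f s R] that by simp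
  have P_A: "space (\<pi> s) = actions M" "prob_space (\<pi> s)"
    if "\<pi> \<in> stable_policies \<kappa> w M" "s \<in> states M" for \<pi> s
    using M.policy_simps[OF M.stable_policy[OF that(1)] that(2)] by auto
  have P_N: "space (\<pi> s) = actions M" "prob_space (\<pi> s)"
    if "\<pi> \<in> stable_policies \<kappa> w N" "s \<in> states M" for \<pi> s
    using N.policy_simps[OF N.stable_policy[OF that(1)], of s] that(2) by auto
  show "\<bar>pol_step A \<pi> f s - pol_step N \<pi> f s\<bar> \<le> R"
    if \<pi>: "\<pi> \<in> stable_policies \<kappa> w M" "\<pi> \<in> stable_policies \<kappa> w N"
      and f: "wbounded (states M) w f" and s: "s \<in> states M"
      and R: "\<And>a. a \<in> actions M \<Longrightarrow> \<bar>pol_step A (open_loop M a) f s - pol_step N (open_loop M a) f s\<bar> \<le> R"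
  proof -
    have "ereal (pol_step A \<pi> f s + 0) \<le> ereal (pol_step N \<pi> f s + R)"
      unfolding avg_A[OF \<pi>(1) f s] avg_N[OF \<pi>(2) f s]
      using R by (intro eint_mono) (force simp: P_A[OF \<pi>(1) s] abs_le_iff)
    moreover have "ereal (pol_step N \<pi> f s + 0) \<le> ereal (pol_step A \<pi> f s + R)"
      unfolding avg_A[OF \<pi>(1) f s] avg_N[OF \<pi>(2) f s]
      using R by (intro eint_mono) (force simp: P_A[OF \<pi>(1) s] abs_le_iff)
    ultimately show ?thesis
      by (simp add: abs_le_iff)
  qed
  show "L \<le> pol_step A \<pi> f s"
    if "\<pi> \<in> stable_policies \<kappa> w M" "wbounded (states M) w f" "s \<in> states M"
      "\<And>a. a \<in> actions M \<Longrightarrow> L \<le> pol_step A (open_loop M a) f s"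
  proof -
    have "ereal L = eint (\<pi> s) (\<lambda>_. ereal L)"
      by (simp add: eint_const P_A[OF that(1,3)])
    also have "\<dots> \<le> ereal (pol_step A \<pi> f s + 0)"
      unfolding avg_A[OF that(1-3)] by (rule eint_mono) (simp add: P_A[OF that(1,3)] that(4))
    finally show ?thesis
      by simp
  qed
  show "L \<le> pol_step N \<pi> f s"
    if "\<pi> \<in> stable_policies \<kappa> w N" "wbounded (states M) w f" "s \<in> states M"
      "\<And>a. a \<in> actions M \<Longrightarrow> L \<le> pol_step N (open_loop M a) f s"
  proof -
    have "ereal L = eint (\<pi> s) (\<lambda>_. ereal L)"
      by (simp add: eint_const P_N[OF that(1,3)])
    also have "\<dots> \<le> ereal (pol_step N \<pi> f s + 0)"
      unfolding avg_N[OF that(1-3)] by (rule eint_mono) (simp add: P_N[OF that(1,3)] that(4))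
    finally show ?thesis
      by simp
  qed
qed

lemma eps_open_loop_le:
  assumes a: "a \<in> actions M"
  shows "eps \<alpha>1 \<alpha>2 w M N (open_loop M a) (open_loop M a) \<le> eps_max \<alpha>1 \<alpha>2 w M N"
  unfolding eps_def wnorm_def
proof (rule SUP_least)
  fix s assume s: "s \<in> states M"
  have N: "cost_pol N (open_loop M a) s = ereal (cost N (s, a))"
    using N.open_loop_cost[of s a] a s by simp
  show "e2ennreal (\<bar>ereal \<alpha>1 * cost_pol M (open_loop M a) s + ereal \<alpha>2 - cost_pol N (open_loop M a) s\<bar> / ereal (w s))
      \<le> eps_max \<alpha>1 \<alpha>2 w M N"
    unfolding eps_max_def using a s M.w_pos[OF s]
    by (intro SUP_upper2[of "(s, a)"]) (simp_all add: M.open_loop_cost[OF s a] N)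
qed

lemma delta_open_loop_le:
  assumes a: "a \<in> actions M"
  shows "delta F w M N (open_loop M a) (open_loop M a) \<le> delta_max F w M N"
  unfolding delta_def
proof (rule SUP_least)
  fix s assume s: "s \<in> states M"
  have N: "kernel_pol N (open_loop M a) s = kernel N (s, a)"
    using N.open_loop_kernel[of s a] a s by simp
  show "ipm F (kernel_pol M (open_loop M a) s) (kernel_pol N (open_loop M a) s) / ennreal (w s)
      \<le> delta_max F w M N"
    unfolding delta_max_def using a s
    by (intro SUP_upper2[of "(s, a)"]) (simp_all add: M.open_loop_kernel[OF s a] N)
qed

end

section \<open>Comparison of values in the two models\<close>

lemma ext_mult_mono: "y \<le> z \<Longrightarrow> x \<odot> y \<le> x \<odot> z"
  by (auto simp: ext_mult_def top_unique intro: mult_left_mono)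

lemma ext_mult_add: "x \<odot> (y + z) = x \<odot> y + x \<odot> z"
  by (auto simp: ext_mult_def distrib_left)

text \<open>
  In the application, \<open>u\<close> and \<open>z\<close> are the optimal value functions of \<open>M\<close> and \<open>N\<close>, and \<open>v\<close> is the value
  function of \<open>\<pi>h\<close> in \<open>M\<close>. Only the fixed point equations and the inequalities expressing optimality
  are retained.
\<close>

locale policy_comparison = model_pair M N w \<kappa> \<alpha>1 \<alpha>2
  for M N :: "('s::polish_space, 'a::polish_space) mdp" and w \<kappa> \<alpha>1 \<alpha>2 +
  fixes \<pi>s \<pi>h :: "'s \<Rightarrow> 'a measure" and u v z :: "'s \<Rightarrow> real"
  assumes \<pi>s: "\<pi>s \<in> stable_policies \<kappa> w M"
    and \<pi>h: "\<pi>h \<in> stable_policies \<kappa> w M" "\<pi>h \<in> stable_policies \<kappa> w N"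
    and wb: "wbounded (states M) w u" "wbounded (states M) w v" "wbounded (states M) w z"
    and u_fix: "\<And>s. s \<in> states M \<Longrightarrow> u s = pol_step M \<pi>s u s"
    and u_le: "\<And>\<mu> s. \<mu> \<in> stable_policies \<kappa> w M \<Longrightarrow> s \<in> states M \<Longrightarrow> u s \<le> pol_step M \<mu> u s"
    and z_fix: "\<And>s. s \<in> states M \<Longrightarrow> z s = pol_step N \<pi>h z s"
    and z_le: "\<And>\<mu> s. \<mu> \<in> stable_policies \<kappa> w N \<Longrightarrow> s \<in> states M \<Longrightarrow> z s \<le> pol_step N \<mu> z s"
    and v_fix: "\<And>s. s \<in> states M \<Longrightarrow> v s = pol_step M \<pi>h v s"
begin

text \<open>
  The value of \<open>\<pi>h\<close> and the optimal value in the affinely transformed model \<open>A\<close>.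
\<close>

definition x :: "'s \<Rightarrow> real" where "x s = \<alpha>1 * v s + \<alpha>2 / (1 - disc M)"
definition y :: "'s \<Rightarrow> real" where "y s = \<alpha>1 * u s + \<alpha>2 / (1 - disc M)"

abbreviation q :: real where "q \<equiv> disc M * \<kappa>"

lemma q: "0 \<le> q" "q < 1"
  using M.contraction_factor_nonneg M.contracting .

lemma wb_xy: "wbounded (states M) w x" "wbounded (states M) w y"
  unfolding x_def[abs_def] y_def[abs_def] using \<alpha>1_pos wb
  by (auto intro!: wbounded_affine simp: M.w_ge_1)

lemma stable_A: "\<pi>s \<in> stable_policies \<kappa> w A" "\<pi>h \<in> stable_policies \<kappa> w A"
  by (intro M.stable_affine \<alpha>1_pos \<pi>s \<pi>h)+

lemma x_fix: "s \<in> states M \<Longrightarrow> x s = pol_step A \<pi>h x s"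
  using M.pol_step_affine[OF \<alpha>1_pos \<pi>h(1) wb(2)] v_fix by (simp add: x_def[abs_def])

lemma y_fix: "s \<in> states M \<Longrightarrow> y s = pol_step A \<pi>s y s"
  using M.pol_step_affine[OF \<alpha>1_pos \<pi>s wb(1)] u_fix by (simp add: y_def[abs_def])

lemma y_le: "\<mu> \<in> stable_policies \<kappa> w M \<Longrightarrow> s \<in> states M \<Longrightarrow> y s \<le> pol_step A \<mu> y s"
  using M.pol_step_affine[OF \<alpha>1_pos _ wb(1)] u_le \<alpha>1_pos by (simp add: y_def[abs_def])

lemma dist_x_z:
  assumes "0 \<le> E"
    and "\<And>s. s \<in> states M \<Longrightarrow> \<bar>pol_step A \<pi>h z s - pol_step N \<pi>h z s\<bar> \<le> E * w s"
    and s: "s \<in> states M"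
  shows "\<bar>x s - z s\<bar> \<le> E / (1 - q) * w s"
  using A.perturbation[OF stable_A(2) stable_A(2), of x z E s] assms wb_xy wb x_fix z_fix by simp

text \<open>
  The policy \<open>\<mu>\<close> is either \<open>\<pi>s\<close> itself or a policy that is greedy for \<open>z\<close> in \<open>A\<close>.
\<close>

lemma dist_y_z_via_A:
  assumes \<mu>: "\<mu> \<in> stable_policies \<kappa> w M"
    and "\<And>s. s \<in> states M \<Longrightarrow> pol_step A \<mu> z s \<le> pol_step A \<pi>s z s" and "0 \<le> E"
    and "\<And>s. s \<in> states M \<Longrightarrow> \<bar>pol_step A \<mu> z s - pol_step N \<pi>h z s\<bar> \<le> E * w s"
    and s: "s \<in> states M"
  shows "\<bar>y s - z s\<bar> \<le> E / (1 - q) * w s"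
  using A.perturbation[OF stable_A(1) M.stable_affine[OF \<alpha>1_pos \<mu>], of y z E s]
    assms wb_xy wb y_fix y_le[OF \<mu>] z_fix by simp

text \<open>
  The mirror image of the previous lemma, with \<open>N\<close> as the contracting model: \<open>\<mu>\<close> is either \<open>\<pi>h\<close> itself
  or a policy that is greedy for \<open>y\<close> in \<open>N\<close>.
\<close>

lemma dist_y_z_via_N:
  assumes \<mu>: "\<mu> \<in> stable_policies \<kappa> w N"
    and "\<And>s. s \<in> states M \<Longrightarrow> pol_step N \<mu> y s \<le> pol_step N \<pi>h y s" and "0 \<le> E"
    and "\<And>s. s \<in> states M \<Longrightarrow> \<bar>pol_step A \<pi>s y s - pol_step N \<mu> y s\<bar> \<le> E * w s"
    and s: "s \<in> states M"
  shows "\<bar>y s - z s\<bar> \<le> E / (1 - q) * w s"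
  using N.perturbation[OF \<pi>h(2) \<mu>, of z y E s] assms wb_xy wb y_fix z_fix z_le[OF \<mu>]
  by (simp add: abs_minus_commute)

text \<open>
  Going from \<open>y\<close> through the operator of \<open>\<pi>h\<close> in \<open>A\<close>, the one in \<open>N\<close>, and \<open>z\<close> back to \<open>y\<close> shows that the
  residual of \<open>y\<close> is at most \<open>E + q D + D\<close>.
\<close>

lemma dist_x_y:
  assumes E: "0 \<le> E" "\<And>s. s \<in> states M \<Longrightarrow> \<bar>pol_step A \<pi>h y s - pol_step N \<pi>h y s\<bar> \<le> E * w s"
    and D: "0 \<le> D" "\<And>s. s \<in> states M \<Longrightarrow> \<bar>y s - z s\<bar> \<le> D * w s"
    and s: "s \<in> states M"
  shows "\<bar>x s - y s\<bar> \<le> (E + (1 + q) * D) / (1 - q) * w s"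
proof -
  have "\<bar>pol_step A \<pi>h y s - y s\<bar> \<le> (E + (1 + q) * D) * w s" if s: "s \<in> states M" for s
  proof -
    have "\<bar>pol_step N \<pi>h y s - pol_step N \<pi>h z s\<bar> \<le> q * D * w s"
      using N.pol_step_contraction[OF \<pi>h(2), of y z D s] wb wb_xy D s by simp
    then show ?thesis
      using E(2)[OF s] D(2)[OF s] z_fix[OF s] by (simp add: distrib_right)
  qed
  then show ?thesis
    using A.perturbation[OF stable_A(2) stable_A(2), of x y "E + (1 + q) * D" s] q E(1) D(1) s wb_xy x_fix
    by simp
qed

text \<open>
  For every single action the steps from \<open>y\<close> in \<open>A\<close> and from \<open>z\<close> in \<open>N\<close> differ by at most \<open>q K + E\<close> times
  the weight, whether the models are exchanged at \<open>y\<close> or at \<open>z\<close>. Since \<open>z\<close> lies below all its action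
  steps in \<open>N\<close>, it lies, up to this error, below all action steps of \<open>y\<close> in \<open>A\<close>; averaging over
  \<open>\<pi>s\<close>, for which \<open>y\<close> is a fixed point, gives one inequality, and averaging over \<open>\<pi>h\<close> the other.
  The passage from one model to the other takes place at the level of actions because \<open>\<pi>s\<close> is known
  to be stable for \<open>M\<close> alone.
\<close>

lemma dist_y_z_open_loop:
  assumes ol: "\<forall>a\<in>actions M. open_loop M a \<in> stable_policies \<kappa> w M \<inter> stable_policies \<kappa> w N"
    and f: "f = y \<or> f = z" and E: "0 \<le> E"
    and gap: "\<And>a s. a \<in> actions M \<Longrightarrow> s \<in> states M \<Longrightarrow>
      \<bar>pol_step A (open_loop M a) f s - pol_step N (open_loop M a) f s\<bar> \<le> E * w s"
    and s: "s \<in> states M"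
  shows "\<bar>y s - z s\<bar> \<le> E / (1 - q) * w s"
proof -
  obtain K where K: "0 \<le> K" "\<forall>s\<in>states M. \<bar>y s - z s\<bar> \<le> K * w s"
    using wbounded_diff[OF wb_xy(2) wb(3)] by blast
  show ?thesis
  proof (rule contraction_gap[OF q E _ K _ s])
    show "\<forall>s\<in>states M. 0 < w s"
      using M.w_pos by blast
    fix K s
    assume K: "0 \<le> K" "\<forall>s\<in>states M. \<bar>y s - z s\<bar> \<le> K * w s" and s: "s \<in> states M"
    have ol_gap: "\<bar>pol_step A (open_loop M a) y s - pol_step N (open_loop M a) z s\<bar> \<le> (q * K + E) * w s"
      if a: "a \<in> actions M" for a
    proof -
      have "\<bar>pol_step A (open_loop M a) y s - pol_step A (open_loop M a) z s\<bar> \<le> q * K * w s"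
        using A.pol_step_contraction[OF M.stable_affine[OF \<alpha>1_pos], of "open_loop M a" y z K s]
          ol a K s wb wb_xy by simp
      moreover have "\<bar>pol_step N (open_loop M a) y s - pol_step N (open_loop M a) z s\<bar> \<le> q * K * w s"
        using N.pol_step_contraction[of "open_loop M a" y z K s] ol a K s wb wb_xy by simp
      ultimately show ?thesis
        using gap[OF a s] f unfolding distrib_right by (auto simp: abs_le_iff)
    qed
    have "z s - (q * K + E) * w s \<le> pol_step A \<pi>s y s"
    proof (rule average_A[OF ol \<pi>s wb_xy(2) s])
      fix a assume a: "a \<in> actions M"
      then have "z s \<le> pol_step N (open_loop M a) z s"
        using ol s by (intro z_le) auto
      with ol_gap[OF a] show "z s - (q * K + E) * w s \<le> pol_step A (open_loop M a) y s"
        by linarith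
    qed
    moreover have "y s - (q * K + E) * w s \<le> pol_step N \<pi>h z s"
    proof (rule average_N[OF ol \<pi>h(2) wb(3) s])
      fix a assume a: "a \<in> actions M"
      then have "y s \<le> pol_step A (open_loop M a) y s"
        using ol s by (intro y_le) auto
      with ol_gap[OF a] show "y s - (q * K + E) * w s \<le> pol_step N (open_loop M a) z s"
        by linarith
    qed
    ultimately show "\<bar>y s - z s\<bar> \<le> (q * K + E) * w s"
      using y_fix[OF s] z_fix[OF s] by linarith
  qed
qed

lemma loss_bound_via_z:
  assumes "\<And>s. s \<in> states M \<Longrightarrow> \<bar>x s - z s\<bar> \<le> E1 / (1 - q) * w s"
    and "\<And>s. s \<in> states M \<Longrightarrow> \<bar>y s - z s\<bar> \<le> E2 / (1 - q) * w s"
    and s: "s \<in> states M"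
  shows "\<bar>v s - u s\<bar> \<le> 1 / (\<alpha>1 * (1 - q)) * (E1 + E2) * w s"
proof -
  have "\<alpha>1 * (v s - u s) = (x s - z s) - (y s - z s)"
    by (simp add: x_def y_def algebra_simps)
  then have "\<bar>\<alpha>1 * (v s - u s)\<bar> \<le> (E1 / (1 - q) + E2 / (1 - q)) * w s"
    using assms(1,2)[OF s] unfolding distrib_right by linarith
  then have "\<alpha>1 * \<bar>v s - u s\<bar> \<le> (E1 / (1 - q) + E2 / (1 - q)) * w s"
    using \<alpha>1_pos by (simp add: abs_mult)
  also have "\<dots> = \<alpha>1 * (1 / (\<alpha>1 * (1 - q)) * (E1 + E2) * w s)"
  proof -
    have "E1 / c + E2 / c = \<alpha>1 * (1 / (\<alpha>1 * c) * (E1 + E2))" if "0 < c" for c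
      using that \<alpha>1_pos by (simp add: field_simps)
    from this[of "1 - q"] show ?thesis
      using q by simp
  qed
  finally show ?thesis
    by (rule mult_left_le_imp_le[OF _ \<alpha>1_pos])
qed

lemma loss_bound_via_y:
  assumes "0 \<le> E1" "\<And>s. s \<in> states M \<Longrightarrow> \<bar>pol_step A \<pi>h y s - pol_step N \<pi>h y s\<bar> \<le> E1 * w s"
    and "0 \<le> E2" "\<And>s. s \<in> states M \<Longrightarrow> \<bar>y s - z s\<bar> \<le> E2 / (1 - q) * w s"
    and s: "s \<in> states M"
  shows "\<bar>v s - u s\<bar> \<le> (1 / (\<alpha>1 * (1 - q)) * E1 + (1 + q) / (\<alpha>1 * (1 - q)\<^sup>2) * E2) * w s"
proof -
  have "\<alpha>1 * \<bar>v s - u s\<bar> = \<bar>x s - y s\<bar>"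
    using \<alpha>1_pos by (simp add: x_def y_def abs_mult flip: right_diff_distrib)
  also have "\<dots> \<le> (E1 + (1 + q) * (E2 / (1 - q))) / (1 - q) * w s"
    using dist_x_y[OF assms(1,2) _ assms(4) s] assms(3) q by simp
  also have "\<dots> = \<alpha>1 * ((1 / (\<alpha>1 * (1 - q)) * E1 + (1 + q) / (\<alpha>1 * (1 - q)\<^sup>2) * E2) * w s)"
  proof -
    have "(E1 + (2 - c) * (E2 / c)) / c = \<alpha>1 * (1 / (\<alpha>1 * c) * E1 + (2 - c) / (\<alpha>1 * c\<^sup>2) * E2)"
      if "0 < c" for c
      using that \<alpha>1_pos by (simp add: field_simps power2_eq_square)
    from this[of "1 - q"] show ?thesis
      using q by simp
  qed
  finally show ?thesis
    using \<alpha>1_pos by simp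
qed

end

section \<open>The performance bounds\<close>

text \<open>
  Reduces estimates with values in \<^typ>\<open>ennreal\<close> to real ones: if one of the two terms is infinite,
  then so is the right-hand side, as the coefficients are positive.
\<close>

lemma le_ennreal_combinationI:
  assumes k: "0 < k1" "0 < k2"
    and bound: "\<And>E1 E2. 0 \<le> E1 \<Longrightarrow> 0 \<le> E2 \<Longrightarrow> X1 = ennreal E1 \<Longrightarrow> X2 = ennreal E2 \<Longrightarrow>
      W \<le> ennreal (k1 * E1 + k2 * E2)"
  shows "W \<le> ennreal k1 * X1 + ennreal k2 * X2"
proof (cases "X1 = \<infinity> \<or> X2 = \<infinity>")
  case True
  then show ?thesis
    using k by (auto simp: ennreal_mult_top)
next
  case False
  then obtain E1 E2 where "0 \<le> E1" "0 \<le> E2" "X1 = ennreal E1" "X2 = ennreal E2"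
    by (metis ennreal_cases infinity_ennreal_def)
  with bound[of E1 E2] k show ?thesis
    by (simp add: ennreal_mult ennreal_plus)
qed

theorem theorem5:
  fixes M N :: "('s::polish_space, 'a::polish_space) mdp"
    and w :: "'s \<Rightarrow> real"
    and cmin \<gamma> \<kappa> \<alpha>1 \<alpha>2 :: real
    and \<pi>s \<pi>h :: "'s \<Rightarrow> 'a measure"
    and F :: "('s \<Rightarrow> ereal) set"
  assumes "is_mdp M" and "is_mdp N"
    and "states N = states M" and "actions N = actions M"
    and "disc M = \<gamma>" and "disc N = \<gamma>"
    and "\<forall>x \<in> states M \<times> actions M. cmin \<le> cost M x \<and> cmin \<le> cost N x"
    and "\<forall>s \<in> states M. 1 \<le> w s"
    and "0 < \<kappa>" and "\<gamma> * \<kappa> < 1"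
    and "dp_solvable cmin w M" and "dp_solvable cmin w N"
    and "\<pi>s \<in> greedy M (opt_val M) \<inter> stable_policies \<kappa> w M"
    and "\<pi>h \<in> greedy N (opt_val N) \<inter> stable_policies \<kappa> w M \<inter> stable_policies \<kappa> w N"
    and "0 < \<alpha>1"
    and "F \<subseteq> Vw cmin w M" and "convex_fun_set (states M) F" and "balanced_fun_set (states M) F"
  shows
    "(wnorm (states M) w (\<lambda>s. val M \<pi>h s - opt_val M s)
        \<le> ennreal (1 / (\<alpha>1 * (1 - \<gamma> * \<kappa>))) *
           (eps \<alpha>1 \<alpha>2 w M N \<pi>h \<pi>h + eps \<alpha>1 \<alpha>2 w M N \<pi>s \<pi>h +
            ennreal \<gamma> * (minkowski (states M) F (opt_val N) \<odot>
                          (delta F w M N \<pi>h \<pi>h + delta F w M N \<pi>s \<pi>h))) \<and>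
      wnorm (states M) w (\<lambda>s. val M \<pi>h s - opt_val M s)
        \<le> ennreal (1 / (\<alpha>1 * (1 - \<gamma> * \<kappa>))) *
           (eps \<alpha>1 \<alpha>2 w M N \<pi>h \<pi>h +
            ennreal (\<alpha>1 * \<gamma>) * (minkowski (states M) F (opt_val M) \<odot> delta F w M N \<pi>h \<pi>h)) +
          ennreal ((1 + \<gamma> * \<kappa>) / (\<alpha>1 * (1 - \<gamma> * \<kappa>)^2)) *
           (eps \<alpha>1 \<alpha>2 w M N \<pi>s \<pi>h +
            ennreal (\<alpha>1 * \<gamma>) * (minkowski (states M) F (opt_val M) \<odot> delta F w M N \<pi>s \<pi>h)))
     \<and>
     (\<forall>\<mu> \<in> greedy (affine_mdp \<alpha>1 \<alpha>2 M) (opt_val N) \<inter> stable_policies \<kappa> w M.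
       wnorm (states M) w (\<lambda>s. val M \<pi>h s - opt_val M s)
        \<le> ennreal (1 / (\<alpha>1 * (1 - \<gamma> * \<kappa>))) *
           (eps \<alpha>1 \<alpha>2 w M N \<pi>h \<pi>h + eps \<alpha>1 \<alpha>2 w M N \<mu> \<pi>h +
            ennreal \<gamma> * (minkowski (states M) F (opt_val N) \<odot>
                          (delta F w M N \<pi>h \<pi>h + delta F w M N \<mu> \<pi>h))))
     \<and>
     (\<forall>\<mu>h \<in> greedy N (opt_val (affine_mdp \<alpha>1 \<alpha>2 M)) \<inter> stable_policies \<kappa> w N.
       wnorm (states M) w (\<lambda>s. val M \<pi>h s - opt_val M s)
        \<le> ennreal (1 / (\<alpha>1 * (1 - \<gamma> * \<kappa>))) *
           (eps \<alpha>1 \<alpha>2 w M N \<pi>h \<pi>h +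
            ennreal (\<alpha>1 * \<gamma>) * (minkowski (states M) F (opt_val M) \<odot> delta F w M N \<pi>h \<pi>h)) +
          ennreal ((1 + \<gamma> * \<kappa>) / (\<alpha>1 * (1 - \<gamma> * \<kappa>)^2)) *
           (eps \<alpha>1 \<alpha>2 w M N \<pi>s \<mu>h +
            ennreal (\<alpha>1 * \<gamma>) * (minkowski (states M) F (opt_val M) \<odot> delta F w M N \<pi>s \<mu>h)))
     \<and>
     ((\<forall>a \<in> actions M. open_loop M a \<in> stable_policies \<kappa> w M \<inter> stable_policies \<kappa> w N) \<and>
      greedy M (opt_val N) \<noteq> {} \<and> greedy N (opt_val M) \<noteq> {} \<longrightarrow>
       wnorm (states M) w (\<lambda>s. val M \<pi>h s - opt_val M s)
        \<le> ennreal (2 / (\<alpha>1 * (1 - \<gamma> * \<kappa>))) *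
           (eps_max \<alpha>1 \<alpha>2 w M N +
            ennreal \<gamma> * (minkowski (states M) F (opt_val N) \<odot> delta_max F w M N)) \<and>
       wnorm (states M) w (\<lambda>s. val M \<pi>h s - opt_val M s)
        \<le> ennreal (2 / (\<alpha>1 * (1 - \<gamma> * \<kappa>)^2)) *
           (eps_max \<alpha>1 \<alpha>2 w M N +
            ennreal (\<alpha>1 * \<gamma>) * (minkowski (states M) F (opt_val M) \<odot> delta_max F w M N)))"
proof -
  note ge1 = assms(8) and sols = assms(11,12) and ps = assms(13) and ph = assms(14)
  note [simp] = assms(3,4,5,6)
  interpret model_pair M N w \<kappa> \<alpha>1 \<alpha>2
    using assms(1-10,15) by unfold_locales auto
  have ps': "\<pi>s \<in> greedy M (opt_val M) \<inter> stable_policies \<kappa> w M" and ph': "\<pi>h \<in> stable_policies \<kappa> w M"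
    "\<pi>h \<in> stable_policies \<kappa> w N" "\<pi>h \<in> greedy N (opt_val N) \<inter> stable_policies \<kappa> w N"
    using ps ph by auto
  obtain u where u: "wbounded (states M) w u" "opt_val M = (\<lambda>s\<in>states M. ereal (u s))"
    "bellman_opt M (opt_val M) = opt_val M"
    using M.opt_val_real[OF sols(1)] by blast
  obtain z where z: "wbounded (states N) w z" "opt_val N = (\<lambda>s\<in>states N. ereal (z s))"
    "bellman_opt N (opt_val N) = opt_val N"
    using N.opt_val_real[OF sols(2)] by blast
  obtain v where v: "wbounded (states M) w v" "\<And>s. s \<in> states M \<Longrightarrow> val M \<pi>h s = ereal (v s)"
    "\<And>s. s \<in> states M \<Longrightarrow> v s = pol_step M \<pi>h v s"
    using M.val_real[OF ph'(1)] by blast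
  interpret policy_comparison M N w \<kappa> \<alpha>1 \<alpha>2 \<pi>s \<pi>h u v z
    using ps' ph' u z v M.opt_val_le_pol_step[OF u] N.opt_val_le_pol_step[OF z]
      M.opt_val_eq_pol_step[OF u ps'] N.opt_val_eq_pol_step[OF z ph'(3)]
    by unfold_locales auto
  have z': "wbounded (states M) w z" "opt_val N = (\<lambda>s\<in>states M. ereal (z s))"
    using z by auto
  have q_eq: "q = \<gamma> * \<kappa>"
    by simp
  let ?W = "wnorm (states M) w (\<lambda>s. val M \<pi>h s - opt_val M s)"
  have W: "?W \<le> ennreal B" if "0 \<le> B" "\<And>s. s \<in> states M \<Longrightarrow> \<bar>v s - u s\<bar> \<le> B * w s" for B
    unfolding wnorm_le_iff[OF ge1 that(1)] using that(2) by (simp add: v(2) u(2))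
  let ?Xz = "\<lambda>\<mu> \<mu>'. eps \<alpha>1 \<alpha>2 w M N \<mu> \<mu>' + ennreal \<gamma> * (minkowski (states M) F (opt_val N) \<odot> delta F w M N \<mu> \<mu>')"
  let ?Xy = "\<lambda>\<mu> \<mu>'. eps \<alpha>1 \<alpha>2 w M N \<mu> \<mu>' + ennreal (\<alpha>1 * \<gamma>) * (minkowski (states M) F (opt_val M) \<odot> delta F w M N \<mu> \<mu>')"
  have gap_z: "\<bar>pol_step A \<mu> z s - pol_step N \<mu>' z s\<bar> \<le> E * w s"
    if "\<mu> \<in> stable_policies \<kappa> w M" "\<mu>' \<in> stable_policies \<kappa> w N" "0 \<le> E" "?Xz \<mu> \<mu>' \<le> ennreal E"
      "s \<in> states M" for \<mu> \<mu>' E s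
    using model_gap[OF that(1,2) z', of 1 E F s 0] that(3-5) by simp
  have gap_y: "\<bar>pol_step A \<mu> y s - pol_step N \<mu>' y s\<bar> \<le> E * w s"
    if "\<mu> \<in> stable_policies \<kappa> w M" "\<mu>' \<in> stable_policies \<kappa> w N" "0 \<le> E" "?Xy \<mu> \<mu>' \<le> ennreal E"
      "s \<in> states M" for \<mu> \<mu>' E s
    using model_gap[OF that(1,2) u(1,2), of \<alpha>1 E F s "\<alpha>2 / (1 - disc M)"] that(3-5) \<alpha>1_pos
    by (simp add: y_def[abs_def])
  have k: "0 < 1 / (\<alpha>1 * (1 - \<gamma> * \<kappa>))" "0 < (1 + \<gamma> * \<kappa>) / (\<alpha>1 * (1 - \<gamma> * \<kappa>)\<^sup>2)"
    using \<alpha>1_pos q by (auto intro!: divide_pos_pos mult_pos_pos add_pos_nonneg)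

  \<comment> \<open>The bound with centre \<open>z\<close>, for a policy \<open>\<mu>\<close> of \<open>M\<close> that is inserted between the models.\<close>
  have via_z: "?W \<le> ennreal (1 / (\<alpha>1 * (1 - \<gamma> * \<kappa>))) *
      (eps \<alpha>1 \<alpha>2 w M N \<pi>h \<pi>h + eps \<alpha>1 \<alpha>2 w M N \<mu> \<pi>h +
        ennreal \<gamma> * (minkowski (states M) F (opt_val N) \<odot> (delta F w M N \<pi>h \<pi>h + delta F w M N \<mu> \<pi>h)))"
    if \<mu>: "\<mu> \<in> stable_policies \<kappa> w M"
      and le: "\<And>s. s \<in> states M \<Longrightarrow> pol_step A \<mu> z s \<le> pol_step A \<pi>s z s" for \<mu>
  proof -
    have "?W \<le> ennreal (1 / (\<alpha>1 * (1 - \<gamma> * \<kappa>))) * ?Xz \<pi>h \<pi>h + ennreal (1 / (\<alpha>1 * (1 - \<gamma> * \<kappa>))) * ?Xz \<mu> \<pi>h"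
    proof (rule le_ennreal_combinationI[OF k(1) k(1)])
      fix E1 E2 assume E: "0 \<le> E1" "0 \<le> E2" "?Xz \<pi>h \<pi>h = ennreal E1" "?Xz \<mu> \<pi>h = ennreal E2"
      have "\<bar>v s - u s\<bar> \<le> 1 / (\<alpha>1 * (1 - q)) * (E1 + E2) * w s" if s: "s \<in> states M" for s
        by (rule loss_bound_via_z[OF dist_x_z dist_y_z_via_A[OF \<mu> le] s])
          (use E \<mu> ph' in \<open>auto intro!: gap_z\<close>)
      then show "?W \<le> ennreal (1 / (\<alpha>1 * (1 - \<gamma> * \<kappa>)) * E1 + 1 / (\<alpha>1 * (1 - \<gamma> * \<kappa>)) * E2)"
        using E(1,2) k(1) unfolding q_eq by (intro W) (auto simp: distrib_left)
    qed
    then show ?thesis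
      by (simp add: ext_mult_add distrib_left ac_simps)
  qed

  \<comment> \<open>The bound with centre \<open>y\<close>, for a policy \<open>\<mu>\<close> of \<open>N\<close> that is inserted between the models.\<close>
  have via_y: "?W \<le> ennreal (1 / (\<alpha>1 * (1 - \<gamma> * \<kappa>))) * ?Xy \<pi>h \<pi>h +
      ennreal ((1 + \<gamma> * \<kappa>) / (\<alpha>1 * (1 - \<gamma> * \<kappa>)^2)) * ?Xy \<pi>s \<mu>"
    if \<mu>: "\<mu> \<in> stable_policies \<kappa> w N"
      and le: "\<And>s. s \<in> states M \<Longrightarrow> pol_step N \<mu> y s \<le> pol_step N \<pi>h y s" for \<mu>
  proof (rule le_ennreal_combinationI[OF k])
    fix E1 E2 assume E: "0 \<le> E1" "0 \<le> E2" "?Xy \<pi>h \<pi>h = ennreal E1" "?Xy \<pi>s \<mu> = ennreal E2"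
    have "\<bar>v s - u s\<bar> \<le> (1 / (\<alpha>1 * (1 - q)) * E1 + (1 + q) / (\<alpha>1 * (1 - q)\<^sup>2) * E2) * w s"
      if s: "s \<in> states M" for s
      by (rule loss_bound_via_y[OF E(1) _ E(2) dist_y_z_via_N[OF \<mu> le] s])
        (use E \<mu> ps' ph' in \<open>auto intro!: gap_y\<close>)
    then show "?W \<le> ennreal (1 / (\<alpha>1 * (1 - \<gamma> * \<kappa>)) * E1 + (1 + \<gamma> * \<kappa>) / (\<alpha>1 * (1 - \<gamma> * \<kappa>)\<^sup>2) * E2)"
      using k E(1,2) unfolding q_eq
      by (intro W add_nonneg_nonneg mult_nonneg_nonneg) (simp_all only: less_imp_le)
  qed

  have optimal_z: "?W \<le> ennreal (1 / (\<alpha>1 * (1 - \<gamma> * \<kappa>))) *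
      (eps \<alpha>1 \<alpha>2 w M N \<pi>h \<pi>h + eps \<alpha>1 \<alpha>2 w M N \<pi>s \<pi>h +
        ennreal \<gamma> * (minkowski (states M) F (opt_val N) \<odot> (delta F w M N \<pi>h \<pi>h + delta F w M N \<pi>s \<pi>h)))"
    using via_z[of \<pi>s] ps' by simp
  have optimal_y: "?W \<le> ennreal (1 / (\<alpha>1 * (1 - \<gamma> * \<kappa>))) * ?Xy \<pi>h \<pi>h +
      ennreal ((1 + \<gamma> * \<kappa>) / (\<alpha>1 * (1 - \<gamma> * \<kappa>)^2)) * ?Xy \<pi>s \<pi>h"
    using via_y[of \<pi>h] ph' by simp
  have greedy_A: "?W \<le> ennreal (1 / (\<alpha>1 * (1 - \<gamma> * \<kappa>))) *
      (eps \<alpha>1 \<alpha>2 w M N \<pi>h \<pi>h + eps \<alpha>1 \<alpha>2 w M N \<mu> \<pi>h +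
        ennreal \<gamma> * (minkowski (states M) F (opt_val N) \<odot> (delta F w M N \<pi>h \<pi>h + delta F w M N \<mu> \<pi>h)))"
    if "\<mu> \<in> greedy (affine_mdp \<alpha>1 \<alpha>2 M) (opt_val N) \<inter> stable_policies \<kappa> w M" for \<mu>
    using that M.stable_affine[OF \<alpha>1_pos, of \<mu>] stable_A(1) z'
    by (intro via_z A.greedy_le[of \<mu> "opt_val N" \<pi>s z]) auto
  \<comment> \<open>Identifies \<open>y\<close>, so that a policy greedy for the optimal value of the transformed model is greedy for \<open>y\<close>.\<close>
  have opt_A: "opt_val (affine_mdp \<alpha>1 \<alpha>2 M) = (\<lambda>s\<in>states N. ereal (y s))"
    unfolding M.opt_val_affine[OF \<alpha>1_pos is_opt_val_opt_val[OF sols(1)]] u(2)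
    by (auto simp: y_def)
  have greedy_N: "?W \<le> ennreal (1 / (\<alpha>1 * (1 - \<gamma> * \<kappa>))) * ?Xy \<pi>h \<pi>h +
      ennreal ((1 + \<gamma> * \<kappa>) / (\<alpha>1 * (1 - \<gamma> * \<kappa>)^2)) * ?Xy \<pi>s \<mu>"
    if "\<mu> \<in> greedy N (opt_val (affine_mdp \<alpha>1 \<alpha>2 M)) \<inter> stable_policies \<kappa> w N" for \<mu>
    using that ph' wb_xy(2) by (intro via_y N.greedy_le[OF that _ _ opt_A]) auto

  let ?Xmz = "eps_max \<alpha>1 \<alpha>2 w M N + ennreal \<gamma> * (minkowski (states M) F (opt_val N) \<odot> delta_max F w M N)"
  let ?Xmy = "eps_max \<alpha>1 \<alpha>2 w M N + ennreal (\<alpha>1 * \<gamma>) * (minkowski (states M) F (opt_val M) \<odot> delta_max F w M N)"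
  have open_loop_bounds: "?W \<le> ennreal (2 / (\<alpha>1 * (1 - \<gamma> * \<kappa>))) * ?Xmz \<and> ?W \<le> ennreal (2 / (\<alpha>1 * (1 - \<gamma> * \<kappa>)^2)) * ?Xmy"
    if ol: "\<forall>a\<in>actions M. open_loop M a \<in> stable_policies \<kappa> w M \<inter> stable_policies \<kappa> w N"
  proof
    \<comment> \<open>Both distances to \<open>z\<close> are estimated by the same gap, so the coefficient is doubled.\<close>
    have k2: "ennreal (2 / (\<alpha>1 * (1 - \<gamma> * \<kappa>))) * X =
        ennreal (1 / (\<alpha>1 * (1 - \<gamma> * \<kappa>))) * X + ennreal (1 / (\<alpha>1 * (1 - \<gamma> * \<kappa>))) * X" for X
      using k(1) by (simp add: ennreal_plus[symmetric] flip: distrib_right)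
    show "?W \<le> ennreal (2 / (\<alpha>1 * (1 - \<gamma> * \<kappa>))) * ?Xmz"
      unfolding k2
    proof (rule le_ennreal_combinationI[OF k(1) k(1)])
      fix E E' assume E: "0 \<le> E" "0 \<le> E'" "?Xmz = ennreal E" "?Xmz = ennreal E'"
      then have "E' = E" by simp
      have gap: "\<bar>pol_step A (open_loop M a) z s - pol_step N (open_loop M a) z s\<bar> \<le> E * w s"
        if "a \<in> actions M" "s \<in> states M" for a s
      proof (rule gap_z)
        show "?Xz (open_loop M a) (open_loop M a) \<le> ennreal E"
          unfolding E(3)[symmetric]
          by (intro add_mono mult_left_mono ext_mult_mono eps_open_loop_le delta_open_loop_le that) simp
      qed (use ol that E in auto)
      have "\<bar>v s - u s\<bar> \<le> 1 / (\<alpha>1 * (1 - q)) * (E + E) * w s" if s: "s \<in> states M" for s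
        by (rule loss_bound_via_z[OF dist_x_z dist_y_z_open_loop[OF ol _ E(1) gap] s])
          (use E ph' wb in \<open>auto intro!: average_A_N[OF ol] gap\<close>)
      then show "?W \<le> ennreal (1 / (\<alpha>1 * (1 - \<gamma> * \<kappa>)) * E + 1 / (\<alpha>1 * (1 - \<gamma> * \<kappa>)) * E')"
        using E(1,2) k(1) unfolding q_eq \<open>E' = E\<close> by (intro W) (auto simp: distrib_left)
    qed
    \<comment> \<open>The two coefficients of the bound with centre \<open>y\<close> add up: \<open>(1 - q) + (1 + q) = 2\<close>.\<close>
    have k3: "ennreal (2 / (\<alpha>1 * (1 - \<gamma> * \<kappa>)^2)) * X =
        ennreal (1 / (\<alpha>1 * (1 - \<gamma> * \<kappa>))) * X + ennreal ((1 + \<gamma> * \<kappa>) / (\<alpha>1 * (1 - \<gamma> * \<kappa>)^2)) * X" for X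
    proof -
      have "2 / (\<alpha>1 * (1 - \<gamma> * \<kappa>)^2) = 1 / (\<alpha>1 * (1 - \<gamma> * \<kappa>)) + (1 + \<gamma> * \<kappa>) / (\<alpha>1 * (1 - \<gamma> * \<kappa>)^2)"
      proof -
        have "2 / (\<alpha>1 * c\<^sup>2) = 1 / (\<alpha>1 * c) + (2 - c) / (\<alpha>1 * c\<^sup>2)" if "0 < c" for c
          using that \<alpha>1_pos by (simp add: field_simps power2_eq_square)
        from this[of "1 - \<gamma> * \<kappa>"] show ?thesis
          using q by simp
      qed
      then show ?thesis
        using k by (simp only: ennreal_plus less_imp_le distrib_right)
    qed
    show "?W \<le> ennreal (2 / (\<alpha>1 * (1 - \<gamma> * \<kappa>)^2)) * ?Xmy"
      unfolding k3
    proof (rule le_ennreal_combinationI[OF k])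
      fix E E' assume E: "0 \<le> E" "0 \<le> E'" "?Xmy = ennreal E" "?Xmy = ennreal E'"
      then have "E' = E" by simp
      have gap: "\<bar>pol_step A (open_loop M a) y s - pol_step N (open_loop M a) y s\<bar> \<le> E * w s"
        if "a \<in> actions M" "s \<in> states M" for a s
      proof (rule gap_y)
        show "?Xy (open_loop M a) (open_loop M a) \<le> ennreal E"
          unfolding E(3)[symmetric]
          by (intro add_mono mult_left_mono ext_mult_mono eps_open_loop_le delta_open_loop_le that) simp
      qed (use ol that E in auto)
      have "\<bar>v s - u s\<bar> \<le> (1 / (\<alpha>1 * (1 - q)) * E + (1 + q) / (\<alpha>1 * (1 - q)\<^sup>2) * E) * w s"
        if s: "s \<in> states M" for s
        by (rule loss_bound_via_y[OF E(1) _ E(1) dist_y_z_open_loop[OF ol _ E(1) gap] s])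
          (use E ph' wb_xy in \<open>auto intro!: average_A_N[OF ol] gap\<close>)
      then show "?W \<le> ennreal (1 / (\<alpha>1 * (1 - \<gamma> * \<kappa>)) * E + (1 + \<gamma> * \<kappa>) / (\<alpha>1 * (1 - \<gamma> * \<kappa>)\<^sup>2) * E')"
        using k E(1,2) unfolding q_eq \<open>E' = E\<close>
        by (intro W add_nonneg_nonneg mult_nonneg_nonneg) (simp_all only: less_imp_le)
    qed
  qed
  show ?thesis
    using optimal_z optimal_y greedy_A greedy_N open_loop_bounds by blast
qed

end
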